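(* Every tree $T$ with pathwidth $k\geq 1$ has a plane straight-line drawing using at most $\max\{\Delta(T)-1,1\}$ distinct edge slopes and at most $2k-1$ distinct edge lengths.
   Context: $\Delta(T)$ is the maximum degree of $T$. A (straight-line) drawing of a graph maps its vertices to distinct points in the plane and represents each edge by the closed line segment between its endpoints, such that each edge segment intersects no vertex other than its own endpoints; it is plane if no two edges intersect except at a common endpoint. The slope of an edge is the angle in $[0,\pi)$ from the $x$-axis to the line containing it. The pathwidth of a graph $G$ is the minimum $k$ such that $G$ is a spanning subgraph of an interval graph with no clique on $k+2$ vertices. *)

theory Defs
  imports "HOL-Analysis.Analysis" "HOL-Library.Ramsey"
begin

text \<open>A finite simple graph is a pair of a vertex set \<open>V\<close> and a set \<open>E\<close> of two-element subsets
  of \<open>V\<close>.  The \<open>tree\<close> predicate of the AFP entry \<open>Graph_Theory\<close> is not used: it forbids directed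
  cycles, so it fails for a symmetric digraph with an edge and holds for some orientations
  of undirected cycles.\<close>

definition simple_graph :: "'a set \<Rightarrow> 'a set set \<Rightarrow> bool" where
  "simple_graph V E \<longleftrightarrow> finite V \<and> E \<subseteq> nsets V 2"

definition graph_connected :: "'a set \<Rightarrow> 'a set set \<Rightarrow> bool" where
  "graph_connected V E \<longleftrightarrow> V \<noteq> {} \<and> (\<forall>u\<in>V. \<forall>v\<in>V. (u, v) \<in> {(x, y). {x, y} \<in> E}\<^sup>*)"

definition graph_cycle :: "'a set set \<Rightarrow> 'a list \<Rightarrow> bool" where
  "graph_cycle E vs \<longleftrightarrow> 3 \<le> length vs \<and> distinct vs \<and>
     (\<forall>i < length vs. {vs ! i, vs ! (Suc i mod length vs)} \<in> E)"

definition graph_tree :: "'a set \<Rightarrow> 'a set set \<Rightarrow> bool" where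
  "graph_tree V E \<longleftrightarrow> simple_graph V E \<and> graph_connected V E \<and> (\<nexists>vs. graph_cycle E vs)"

definition vertex_degree :: "'a set set \<Rightarrow> 'a \<Rightarrow> nat" where
  "vertex_degree E v = card {e \<in> E. v \<in> e}"

definition max_degree :: "'a set \<Rightarrow> 'a set set \<Rightarrow> nat" where
  "max_degree V E = Max (vertex_degree E ` V)"

definition interval_graph :: "'a set \<Rightarrow> 'a set set \<Rightarrow> bool" where
  "interval_graph V E \<longleftrightarrow> simple_graph V E \<and>
     (\<exists>l r :: 'a \<Rightarrow> real. (\<forall>v\<in>V. l v \<le> r v) \<and>
       (\<forall>u\<in>V. \<forall>v\<in>V. u \<noteq> v \<longrightarrow> ({u, v} \<in> E \<longleftrightarrow> {l u..r u} \<inter> {l v..r v} \<noteq> {})))"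

definition pathwidth :: "'a set \<Rightarrow> 'a set set \<Rightarrow> nat" where
  "pathwidth V E = (LEAST k. \<exists>F. interval_graph V F \<and> E \<subseteq> F \<and>
     \<not> (\<exists>K. K \<subseteq> V \<and> card K = k + 2 \<and> clique K F))"

text \<open>The predicate under \<open>LEAST\<close> is satisfiable: all intervals may be equal.\<close>

lemma pathwidth_witness:
  assumes "simple_graph V E"
  shows "\<exists>k F. interval_graph V F \<and> E \<subseteq> F \<and> \<not> (\<exists>K. K \<subseteq> V \<and> card K = k + 2 \<and> clique K F)"
proof (intro exI conjI)
  have "finite V" using assms by (simp add: simple_graph_def)
  show "interval_graph V (nsets V 2)"
    unfolding interval_graph_def simple_graph_def
    using \<open>finite V\<close>
    by (auto simp: nsets_def intro!: exI[of _ "\<lambda>_. 0"])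
  show "E \<subseteq> nsets V 2" using assms by (simp add: simple_graph_def)
  show "\<not> (\<exists>K. K \<subseteq> V \<and> card K = card V + 2 \<and> clique K (nsets V 2))"
  proof
    assume "\<exists>K. K \<subseteq> V \<and> card K = card V + 2 \<and> clique K (nsets V 2)"
    then obtain K where "K \<subseteq> V" "card K = card V + 2" by blast
    then show False using card_mono[OF \<open>finite V\<close>, of K] by linarith
  qed
qed

text \<open>The plane is the type \<^typ>\<open>complex\<close>.\<close>

definition straight_line_drawing :: "'a set \<Rightarrow> 'a set set \<Rightarrow> ('a \<Rightarrow> complex) \<Rightarrow> bool" where
  "straight_line_drawing V E p \<longleftrightarrow> inj_on p V \<and>
     (\<forall>u v. {u, v} \<in> E \<longrightarrow> (\<forall>w\<in>V. p w \<in> closed_segment (p u) (p v) \<longrightarrow> w \<in> {u, v}))"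

definition plane_drawing :: "'a set \<Rightarrow> 'a set set \<Rightarrow> ('a \<Rightarrow> complex) \<Rightarrow> bool" where
  "plane_drawing V E p \<longleftrightarrow> straight_line_drawing V E p \<and>
     (\<forall>u v x y. {u, v} \<in> E \<longrightarrow> {x, y} \<in> E \<longrightarrow> {u, v} \<noteq> {x, y} \<longrightarrow>
        closed_segment (p u) (p v) \<inter> closed_segment (p x) (p y) \<subseteq> p ` ({u, v} \<inter> {x, y}))"

text \<open>The factor \<open>r\<close> may be negative, so the value depends only on the line through
  \<open>a\<close> and \<open>b\<close>, not on the order of the two points.\<close>

definition slope :: "complex \<Rightarrow> complex \<Rightarrow> real" where
  "slope a b = (THE \<theta>. 0 \<le> \<theta> \<and> \<theta> < pi \<and> (\<exists>r::real. b - a = of_real r * cis \<theta>))"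

lemma slope_unique:
  assumes "a \<noteq> b"
  shows "\<exists>!\<theta>. 0 \<le> \<theta> \<and> \<theta> < pi \<and> (\<exists>r::real. b - a = of_real r * cis \<theta>)"
proof -
  define z where "z = b - a"
  have "z \<noteq> 0" using assms by (simp add: z_def)
  have z: "z = of_real (cmod z) * cis (Arg z)"
    using rcis_cmod_Arg[of z] unfolding rcis_def by (rule sym)
  show ?thesis unfolding z_def[symmetric]
  proof (rule ex_ex1I)
    show "\<exists>\<theta>. 0 \<le> \<theta> \<and> \<theta> < pi \<and> (\<exists>r::real. z = of_real r * cis \<theta>)"
    proof -
      consider "0 \<le> Arg z" "Arg z < pi" | "Arg z = pi" | "Arg z < 0" "- pi < Arg z"
        using Arg_bounded[of z] by linarith
      then show ?thesis
      proof cases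
        case 1
        then show ?thesis using z by blast
      next
        case 2
        then have "z = of_real (- cmod z) * cis 0" by (subst z) simp
        then show ?thesis using pi_gt_zero by blast
      next
        case 3
        have "cis (Arg z + pi) = - cis (Arg z)" by (simp add: complex_eq_iff)
        then have "z = of_real (- cmod z) * cis (Arg z + pi)" by (subst z) simp
        moreover have "0 \<le> Arg z + pi" "Arg z + pi < pi" using 3 by auto
        ultimately show ?thesis by blast
      qed
    qed
  next
    fix s t
    assume s: "0 \<le> s \<and> s < pi \<and> (\<exists>r::real. z = of_real r * cis s)"
      and t: "0 \<le> t \<and> t < pi \<and> (\<exists>r::real. z = of_real r * cis t)"
    then obtain q r where q: "z = of_real q * cis s" and r: "z = of_real r * cis t" by blast
    have "q \<noteq> 0" using q \<open>z \<noteq> 0\<close> by auto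
    have "of_real q * cis s * cis (- t) = of_real r * cis t * cis (- t)" using q r by simp
    then have "of_real q * cis (s - t) = of_real r"
      by (simp add: mult.assoc cis_mult)
    then have "Im (of_real q * cis (s - t)) = Im (of_real r)" by simp
    then have "sin (s - t) = 0" using \<open>q \<noteq> 0\<close> by simp
    then show "s = t" using s t sin_eq_0_pi[of "s - t"] by linarith
  qed
qed

definition edge_slopes :: "'a set set \<Rightarrow> ('a \<Rightarrow> complex) \<Rightarrow> real set" where
  "edge_slopes E p = {slope (p u) (p v) | u v. {u, v} \<in> E}"

definition edge_lengths :: "'a set set \<Rightarrow> ('a \<Rightarrow> complex) \<Rightarrow> real set" where
  "edge_lengths E p = {dist (p u) (p v) | u v. {u, v} \<in> E}"

end

theory Submission
  imports Defs "HOL-Library.Transitive_Closure_Table"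
begin

text \<open>
  In an interval representation of width \<open>k\<close>, a path of the tree from a vertex with leftmost
  interval to one with rightmost interval covers every point of the representation, so removing it
  leaves components of pathwidth less than \<open>k\<close>.  Hence, by induction on \<open>k\<close>, a tree with an
  arbitrary root decomposes into nested downward heavy paths with at most \<open>2 * k\<close> levels: follow
  the path from the root until it reaches the covering path and then one half of that path; the
  other half starts a heavy path of level \<open>2 * k - 1\<close>.  If the root is an end of the covering
  path, \<open>2 * k - 1\<close> levels suffice; prolonging the path makes the root a leaf, after which every
  vertex has at most \<open>\<Delta> - 1\<close> children.

  Assign one direction to each of the \<open>\<Delta> - 1\<close> child positions: heavy edges are horizontal, the
  others have angles of at least 60 and less than 90 degrees, and all edges of a level, including
  those to the heavy paths one level below, have the same length.  If the lengths decrease fast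
  enough from level to level, the subtree at the end of a non-heavy edge stays in a thin wedge
  around that edge, while the subtree at the end of the heavy edge lies farther to the right than
  all of these.
\<close>

subsection \<open>Rooted trees\<close>

text \<open>Only the set of children of a node matters; lists serve to nest the datatype.\<close>

datatype (verts: 'a) rtree = Node (apex: 'a) (children: "'a rtree list")

fun edges :: "'a rtree \<Rightarrow> 'a set set" where
  "edges (Node a cs) = (\<Union>c\<in>set cs. insert {a, apex c} (edges c))"

fun subtrees :: "'a rtree \<Rightarrow> 'a rtree set" where
  "subtrees (Node a cs) = insert (Node a cs) (\<Union>c\<in>set cs. subtrees c)"

fun distinct_verts :: "'a rtree \<Rightarrow> bool" where
  "distinct_verts (Node a cs) \<longleftrightarrow> (\<forall>c\<in>set cs. a \<notin> verts c) \<and>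
     disjoint_family_on verts (set cs) \<and> (\<forall>c\<in>set cs. distinct_verts c)"

fun arity_le :: "nat \<Rightarrow> 'a rtree \<Rightarrow> bool" where
  "arity_le d (Node a cs) \<longleftrightarrow> card (set cs) \<le> d \<and> (\<forall>c\<in>set cs. arity_le d c)"

lemma apex_in_verts [simp]: "apex t \<in> verts t"
  by (cases t) simp

lemma finite_verts [simp]: "finite (verts t)"
  by (induction t) simp

lemma edges_subset_verts: "e \<in> edges t \<Longrightarrow> e \<subseteq> verts t"
proof (induction t)
  case (Node a cs)
  then obtain c where "c \<in> set cs" "e = {a, apex c} \<or> e \<in> edges c" by auto
  moreover from this have "e \<subseteq> insert a (verts c)" using Node.IH[of c] apex_in_verts[of c] by auto
  ultimately show ?case by auto
qed

lemma subtree_self: "t \<in> subtrees t"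
  by (cases t) simp

lemma distinct_verts_disjoint:
  assumes "distinct_verts (Node a cs)" "c \<in> set cs" "c' \<in> set cs" "c \<noteq> c'" "P \<subseteq> verts c'"
  shows "verts c \<inter> P = {}"
  using assms disjoint_family_onD[of verts "set cs" c c'] by auto

lemma distinct_verts_subset:
  assumes "distinct_verts (Node a cs)" "set cs' \<subseteq> set cs"
  shows "distinct_verts (Node a cs')"
  using assms by (auto intro: disjoint_family_on_mono)

lemma distinct_verts_Cons:
  assumes "distinct_verts (Node a cs)" "distinct_verts c" "a \<notin> verts c"
    and "\<And>x. x \<in> set cs \<Longrightarrow> verts x \<inter> verts c = {}"
  shows "distinct_verts (Node a (c # cs))"
  using assms by (auto simp: disjoint_family_on_def Int_commute)

lemma card_verts_child_less:
  assumes "distinct_verts (Node a cs)" "c \<in> set cs"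
  shows "card (verts c) < card (verts (Node a cs))"
proof (rule psubset_card_mono)
  have "a \<notin> verts c" using assms by simp
  then show "verts c \<subset> verts (Node a cs)" using assms(2) by auto
qed simp

lemma verts_subtree: "s \<in> subtrees t \<Longrightarrow> verts s \<subseteq> verts t"
  by (induction t) auto

lemma edges_subtree: "s \<in> subtrees t \<Longrightarrow> edges s \<subseteq> edges t"
  by (induction t) auto

lemma distinct_verts_subtree: "distinct_verts t \<Longrightarrow> s \<in> subtrees t \<Longrightarrow> distinct_verts s"
  by (induction t) auto

subsection \<open>Heavy paths\<close>

text \<open>The child \<open>h\<close> continues the current heavy path, at the same level; every other child starts a
  heavy path one level below.\<close>

fun levels_le :: "nat \<Rightarrow> 'a rtree \<Rightarrow> bool" where
  "levels_le m (Node a cs) \<longleftrightarrow> cs = [] \<or>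
     1 \<le> m \<and> (\<exists>h\<in>set cs. \<forall>c\<in>set cs. levels_le (if c = h then m else m - 1) c)"

lemma levels_le_mono: "levels_le m t \<Longrightarrow> m \<le> n \<Longrightarrow> levels_le n t"
proof (induction t arbitrary: m n)
  case (Node a cs)
  show ?case
  proof (cases "cs = []")
    case False
    then obtain h where pos: "1 \<le> m" and heavy: "h \<in> set cs"
      "\<And>c. c \<in> set cs \<Longrightarrow> levels_le (if c = h then m else m - 1) c"
      using Node.prems(1) by auto
    have "levels_le (if c = h then n else n - 1) c" if "c \<in> set cs" for c
      using Node.IH[OF that heavy(2)[OF that]] Node.prems(2) by auto
    then show ?thesis using pos heavy(1) Node.prems(2) unfolding levels_le.simps by (meson le_trans)
  qed simp
qed

lemma levels_le_Node:
  assumes "h \<in> set cs" "levels_le (Suc m) h"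
    and "\<And>c. c \<in> set cs \<Longrightarrow> c \<noteq> h \<Longrightarrow> levels_le m c"
  shows "levels_le (Suc m) (Node a cs)"
  using assms by auto

lemma levels_le_Node_if_children:
  assumes "\<And>c. c \<in> set cs \<Longrightarrow> levels_le m c"
  shows "levels_le (Suc m) (Node a cs)"
proof (cases cs)
  case (Cons h cs')
  then show ?thesis
    using assms levels_le_mono[of m h "Suc m"] by (intro levels_le_Node[of h]) auto
qed simp

text \<open>Paths are represented by their vertex sets.\<close>

inductive down_path :: "'a rtree \<Rightarrow> 'a set \<Rightarrow> bool" where
  down_top: "down_path (Node a cs) {a}"
| down_step: "c \<in> set cs \<Longrightarrow> down_path c P \<Longrightarrow> down_path (Node a cs) (insert a P)"

inductive bent_path :: "'a rtree \<Rightarrow> 'a set \<Rightarrow> bool" where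
  bent_down: "down_path t P \<Longrightarrow> bent_path t P"
| bent_step: "c \<in> set cs \<Longrightarrow> bent_path c P \<Longrightarrow> bent_path (Node a cs) P"
| bent_join: "c \<in> set cs \<Longrightarrow> c' \<in> set cs \<Longrightarrow> c \<noteq> c' \<Longrightarrow> down_path c P \<Longrightarrow> down_path c' Q \<Longrightarrow>
    bent_path (Node a cs) (insert a (P \<union> Q))"

lemma down_path_subset_verts: "down_path t P \<Longrightarrow> P \<subseteq> verts t"
  by (induction rule: down_path.induct) auto

lemma bent_path_subset_verts: "bent_path t P \<Longrightarrow> P \<subseteq> verts t"
  by (induction rule: bent_path.induct) (auto dest: down_path_subset_verts)

lemma apex_in_down_path: "down_path t P \<Longrightarrow> apex t \<in> P"
  by (cases rule: down_path.cases) auto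

lemma down_path_apex: "down_path t {apex t}"
  by (cases t) (simp add: down_top)

lemma ex_down_path_to:
  assumes "v \<in> verts t"
  shows "\<exists>P. down_path t P \<and> v \<in> P"
  using assms
proof (induction t)
  case (Node a cs)
  show ?case
  proof (cases "v = a")
    case True
    then show ?thesis using down_top[of a cs] by auto
  next
    case False
    then obtain c where child: "c \<in> set cs" "v \<in> verts c" using Node.prems by auto
    then obtain P where "down_path c P" "v \<in> P" using Node.IH by blast
    then show ?thesis using down_step[OF child(1)] by blast
  qed
qed

lemma ex_bent_path_between:
  assumes "u \<in> verts t" "v \<in> verts t"
  shows "\<exists>P. bent_path t P \<and> u \<in> P \<and> v \<in> P"
  using assms
proof (induction t)
  case (Node a cs)
  consider (apex) w where "w \<in> verts (Node a cs)" "{u, v} = {a, w}"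
    | (inner) c c' where "c \<in> set cs" "u \<in> verts c" "c' \<in> set cs" "v \<in> verts c'"
    using Node.prems by auto
  then show ?case
  proof cases
    case apex
    obtain P where "down_path (Node a cs) P" "w \<in> P" using ex_down_path_to[OF apex(1)] by blast
    moreover have "a \<in> P" using apex_in_down_path[OF calculation(1)] by simp
    ultimately show ?thesis
      using apex(2) bent_down by (metis insert_subset subset_insertI empty_subsetI)
  next
    case inner
    show ?thesis
    proof (cases "c = c'")
      case True
      then show ?thesis using Node.IH inner bent_step by metis
    next
      case False
      obtain P where "down_path c P" "u \<in> P" using ex_down_path_to[OF inner(2)] by blast
      moreover obtain Q where "down_path c' Q" "v \<in> Q" using ex_down_path_to[OF inner(4)] by blast
      ultimately show ?thesis using bent_join[OF inner(1,3) False] by blast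
    qed
  qed
qed

definition levels_off_le :: "nat \<Rightarrow> 'a set \<Rightarrow> 'a rtree \<Rightarrow> bool" where
  "levels_off_le m P t \<longleftrightarrow> (\<forall>s\<in>subtrees t. verts s \<inter> P = {} \<longrightarrow> levels_le m s)"

lemma levels_off_le_child:
  assumes "levels_off_le m P (Node a cs)" "c \<in> set cs" "verts c \<inter> P \<subseteq> Q"
  shows "levels_off_le m Q c"
  using assms verts_subtree[of _ c] unfolding levels_off_le_def by fastforce

lemma levels_le_child_off:
  assumes "levels_off_le m P (Node a cs)" "c \<in> set cs" "verts c \<inter> P = {}"
  shows "levels_le m c"
  using assms subtree_self[of c] unfolding levels_off_le_def by auto

lemma levels_le_down_path:
  assumes "down_path t P" "distinct_verts t" "levels_off_le m P t"
  shows "levels_le (Suc m) t"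
  using assms
proof (induction rule: down_path.induct)
  case (down_top a cs)
  have "levels_le m c" if "c \<in> set cs" for c
    using down_top.prems(1) that by (intro levels_le_child_off[OF down_top.prems(2)]) auto
  then show ?case by (rule levels_le_Node_if_children)
next
  case (down_step c cs P a)
  note distinct = down_step.prems(1) and off_path = down_step.prems(2)
  have "levels_off_le m P c"
    using distinct down_step.hyps(1)
    by (intro levels_off_le_child[OF off_path down_step.hyps(1)]) auto
  then have "levels_le (Suc m) c" using down_step.IH down_step.hyps(1) distinct by simp
  moreover have "levels_le m x" if sibling: "x \<in> set cs" "x \<noteq> c" for x
  proof (rule levels_le_child_off[OF off_path sibling(1)])
    have "verts x \<inter> P = {}"
      using distinct_verts_disjoint[OF distinct sibling(1) down_step.hyps(1) sibling(2)]
        down_path_subset_verts[OF down_step.hyps(2)] .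
    then show "verts x \<inter> insert a P = {}" using distinct sibling(1) by simp
  qed
  ultimately show ?case using down_step.hyps(1) by (rule levels_le_Node[rotated])
qed

lemma levels_le_two_down_paths:
  assumes distinct: "distinct_verts (Node a cs)"
    and off_path: "levels_off_le m (insert a (P \<union> Q)) (Node a cs)"
    and children: "c \<in> set cs" "c' \<in> set cs" "c \<noteq> c'"
    and paths: "down_path c P" "down_path c' Q"
  shows "levels_le (Suc (Suc m)) (Node a cs)"
proof -
  note sibling_disjoint = distinct_verts_disjoint[OF distinct]
  have path_subset: "P \<subseteq> verts c" "Q \<subseteq> verts c'"
    using paths down_path_subset_verts by auto
  have "verts c \<inter> Q = {}" "verts c' \<inter> P = {}"
    using sibling_disjoint children path_subset by metis+
  then have "levels_off_le m P c" "levels_off_le m Q c'"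
    using distinct children(1,2) by (auto intro!: levels_off_le_child[OF off_path])
  then have "levels_le (Suc m) c" "levels_le (Suc m) c'"
    using levels_le_down_path children paths distinct unfolding distinct_verts.simps by metis+
  moreover have "levels_le m x" if sibling: "x \<in> set cs" "x \<noteq> c" "x \<noteq> c'" for x
  proof (rule levels_le_child_off[OF off_path sibling(1)])
    have "verts x \<inter> P = {}" "verts x \<inter> Q = {}"
      using sibling_disjoint sibling children(1,2) path_subset by metis+
    then show "verts x \<inter> insert a (P \<union> Q) = {}" using distinct sibling(1) by auto
  qed
  ultimately have "levels_le (Suc m) x" if "x \<in> set cs" for x
    using that levels_le_mono[of m x "Suc m"] by (cases "x = c \<or> x = c'") auto
  then show ?thesis by (rule levels_le_Node_if_children)
qed

lemma levels_le_bent_path: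
  assumes "bent_path t P" "distinct_verts t" "levels_off_le m P t"
  shows "levels_le (Suc (Suc m)) t"
  using assms
proof (induction rule: bent_path.induct)
  case (bent_down t P)
  then have "levels_le (Suc m) t" by (rule levels_le_down_path)
  then show ?case by (rule levels_le_mono) simp
next
  case (bent_step c cs P a)
  note distinct = bent_step.prems(1) and off_path = bent_step.prems(2)
  have "levels_off_le m P c" using levels_off_le_child[OF off_path bent_step.hyps(1)] by simp
  then have "levels_le (Suc (Suc m)) c" using bent_step.IH bent_step.hyps(1) distinct by simp
  moreover have "levels_le (Suc m) x" if sibling: "x \<in> set cs" "x \<noteq> c" for x
  proof (rule levels_le_mono)
    show "levels_le m x"
      using distinct_verts_disjoint[OF distinct sibling(1) bent_step.hyps(1) sibling(2)]
        bent_path_subset_verts[OF bent_step.hyps(2)] levels_le_child_off[OF off_path sibling(1)]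
      by blast
  qed simp
  ultimately show ?case using bent_step.hyps(1) by (rule levels_le_Node[rotated])
next
  case (bent_join c cs c' P Q a)
  then show ?case by (intro levels_le_two_down_paths)
qed

subsection \<open>Interval models\<close>

definition interval_model :: "('a \<Rightarrow> real set) \<Rightarrow> 'a set \<Rightarrow> 'a set set \<Rightarrow> nat \<Rightarrow> bool" where
  "interval_model I V E k \<longleftrightarrow> (\<forall>v\<in>V. \<exists>a b. a \<le> b \<and> I v = {a..b}) \<and>
     (\<forall>u v. {u, v} \<in> E \<longrightarrow> I u \<inter> I v \<noteq> {}) \<and> (\<forall>x. card {v \<in> V. x \<in> I v} \<le> k)"

lemma ex_interval_model_pathwidth:
  assumes simple: "simple_graph V E"
  shows "\<exists>I. interval_model I V E (Suc (pathwidth V E))"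
proof -
  define k where "k = pathwidth V E"
  have "\<exists>F. interval_graph V F \<and> E \<subseteq> F \<and> \<not> (\<exists>K. K \<subseteq> V \<and> card K = k + 2 \<and> clique K F)"
    unfolding k_def pathwidth_def by (rule LeastI_ex) (rule pathwidth_witness[OF simple])
  then obtain F where interval_supergraph: "interval_graph V F" "E \<subseteq> F"
    and no_clique: "\<And>K. K \<subseteq> V \<Longrightarrow> card K = k + 2 \<Longrightarrow> \<not> clique K F"
    by (elim exE conjE) blast
  obtain l r :: "'a \<Rightarrow> real" where nonempty: "\<forall>v\<in>V. l v \<le> r v"
    and adjacent: "\<forall>u\<in>V. \<forall>v\<in>V. u \<noteq> v \<longrightarrow> ({u, v} \<in> F \<longleftrightarrow> {l u..r u} \<inter> {l v..r v} \<noteq> {})"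
    using interval_supergraph(1) unfolding interval_graph_def by (elim exE conjE)
  define I where "I v = {l v..r v}" for v
  have "I u \<inter> I v \<noteq> {}" if "{u, v} \<in> E" for u v
  proof -
    have "{u, v} \<in> nsets V 2" using simple that unfolding simple_graph_def by blast
    then have "u \<in> V" "v \<in> V" "u \<noteq> v" unfolding doubleton_in_nsets_2 by auto
    then show ?thesis using adjacent that interval_supergraph(2) unfolding I_def by blast
  qed
  moreover have "card {v \<in> V. x \<in> I v} \<le> Suc k" for x
  proof (rule ccontr)
    assume "\<not> card {v \<in> V. x \<in> I v} \<le> Suc k"
    then have "k + 2 \<le> card {v \<in> V. x \<in> I v}" by simp
    then obtain K where large: "K \<subseteq> {v \<in> V. x \<in> I v}" "card K = k + 2"
      by (rule obtain_subset_with_card_n)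
    have "clique K F" unfolding clique_def using large(1) adjacent unfolding I_def by blast
    then show False using no_clique large by blast
  qed
  moreover have "\<exists>a b. a \<le> b \<and> I v = {a..b}" if "v \<in> V" for v
    using nonempty that by (auto simp: I_def)
  ultimately have "interval_model I V E (Suc k)" by (simp add: interval_model_def)
  then show ?thesis unfolding k_def by blast
qed

lemma interval_model_subset:
  assumes "interval_model I V E k" "finite V" "V' \<subseteq> V" "E' \<subseteq> E"
  shows "interval_model I V' E' k"
proof -
  have "card {v \<in> V'. x \<in> I v} \<le> card {v \<in> V. x \<in> I v}" for x
    using assms(2,3) by (intro card_mono) auto
  then have "card {v \<in> V'. x \<in> I v} \<le> k" for x
    using assms(1) unfolding interval_model_def by (meson le_trans)
  then show ?thesis using assms unfolding interval_model_def by (meson subsetD)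
qed

lemma interval_model_remove_cover:
  assumes model: "interval_model I V E (Suc k)" and "finite V" "P \<subseteq> V"
    and cover: "\<Union>(I ` V) \<subseteq> \<Union>(I ` P)"
    and sub: "V' \<subseteq> V - P" "E' \<subseteq> E"
  shows "interval_model I V' E' k"
proof -
  have "card {v \<in> V'. x \<in> I v} \<le> k" for x
  proof (cases "{v \<in> V'. x \<in> I v} = {}")
    case True
    then show ?thesis by (metis card.empty le0)
  next
    case False
    then obtain w where "w \<in> P" "x \<in> I w" using cover sub(1) by blast
    then have "{v \<in> V'. x \<in> I v} \<subset> {v \<in> V. x \<in> I v}" using \<open>P \<subseteq> V\<close> sub(1) by auto
    then have "card {v \<in> V'. x \<in> I v} < card {v \<in> V. x \<in> I v}"
      using \<open>finite V\<close> by (intro psubset_card_mono) auto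
    also have "\<dots> \<le> Suc k" using model unfolding interval_model_def by blast
    finally show ?thesis by simp
  qed
  then show ?thesis using model sub unfolding interval_model_def by (meson DiffD1 subsetD)
qed

lemma interval_model_child:
  assumes "interval_model I (verts (Node a cs)) (edges (Node a cs)) k" "c \<in> set cs"
  shows "interval_model I (verts c) (edges c) k"
  by (rule interval_model_subset[OF assms(1)]) (use assms(2) in auto)

lemma connected_Union_down_path:
  assumes "down_path t P" "interval_model I (verts t) (edges t) k"
  shows "connected (\<Union>(I ` P))"
  using assms
proof (induction rule: down_path.induct)
  case (down_top a cs)
  then show ?case by (auto simp: interval_model_def)
next
  case (down_step c cs P a)
  have "connected (\<Union>(I ` P))"
    using down_step.IH interval_model_child[OF down_step.prems down_step.hyps(1)] .
  moreover have "connected (I a)" using down_step.prems by (auto simp: interval_model_def)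
  moreover have "{a, apex c} \<in> edges (Node a cs)" using down_step.hyps(1) by auto
  then have "I a \<inter> I (apex c) \<noteq> {}" using down_step.prems unfolding interval_model_def by blast
  then have "I a \<inter> \<Union>(I ` P) \<noteq> {}" using apex_in_down_path[OF down_step.hyps(2)] by blast
  ultimately show ?case by (simp add: connected_Un)
qed

lemma connected_Union_bent_path:
  assumes "bent_path t P" "interval_model I (verts t) (edges t) k"
  shows "connected (\<Union>(I ` P))"
  using assms
proof (induction rule: bent_path.induct)
  case (bent_down t P)
  then show ?case by (rule connected_Union_down_path)
next
  case (bent_step c cs P a)
  then show ?case using interval_model_child[OF bent_step.prems bent_step.hyps(1)] by simp
next
  case (bent_join c cs c' P Q a)
  have "connected (\<Union>(I ` insert a P))" "connected (\<Union>(I ` insert a Q))"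
    using connected_Union_down_path[OF down_step bent_join.prems] bent_join.hyps by blast+
  moreover have "I a \<noteq> {}" using bent_join.prems by (auto simp: interval_model_def)
  then have "\<Union>(I ` insert a P) \<inter> \<Union>(I ` insert a Q) \<noteq> {}" by blast
  ultimately have "connected (\<Union>(I ` insert a P) \<union> \<Union>(I ` insert a Q))"
    by (rule connected_Un)
  then show ?case by (simp add: Un_assoc Un_left_commute)
qed

lemma interval_model_ends:
  assumes model: "interval_model I V E k" and fin_nonempty: "finite V" "V \<noteq> {}"
  obtains u v where "u \<in> V" "v \<in> V"
    "\<And>P. u \<in> P \<Longrightarrow> v \<in> P \<Longrightarrow> connected (\<Union>(I ` P)) \<Longrightarrow> \<Union>(I ` V) \<subseteq> \<Union>(I ` P)"
proof -
  obtain l r where interval: "\<And>w. w \<in> V \<Longrightarrow> l w \<le> r w \<and> I w = {l w..r w}"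
    using model unfolding interval_model_def by metis
  obtain u where leftmost: "u \<in> V" "Min (l ` V) = l u" using obtains_MIN fin_nonempty by metis
  obtain v where rightmost: "v \<in> V" "Max (r ` V) = r v" using obtains_MAX fin_nonempty by metis
  show thesis
  proof (rule that[OF leftmost(1) rightmost(1)])
    fix P assume connected_cover: "u \<in> P" "v \<in> P" "connected (\<Union>(I ` P))"
    have "l u \<in> I u" "r v \<in> I v" using interval leftmost(1) rightmost(1) by auto
    then have "{l u..r v} \<subseteq> \<Union>(I ` P)" using connected_cover by (intro connected_contains_Icc) auto
    moreover have "I w \<subseteq> {l u..r v}" if "w \<in> V" for w
    proof -
      have "l u \<le> l w" "r w \<le> r v"
        using that fin_nonempty by (simp_all flip: leftmost(2) rightmost(2))
      then show ?thesis using interval[OF that] by auto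
    qed
    ultimately show "\<Union>(I ` V) \<subseteq> \<Union>(I ` P)" by blast
  qed
qed

lemma levels_off_le_cover:
  assumes tree: "distinct_verts t" "interval_model I (verts t) (edges t) (Suc k)"
    and path: "P \<subseteq> verts t" "\<Union>(I ` verts t) \<subseteq> \<Union>(I ` P)"
    and levels: "\<And>s. distinct_verts s \<Longrightarrow> interval_model I (verts s) (edges s) k \<Longrightarrow> levels_le m s"
  shows "levels_off_le m P t"
  unfolding levels_off_le_def
proof (intro ballI impI)
  fix s assume off_path: "s \<in> subtrees t" "verts s \<inter> P = {}"
  have "interval_model I (verts s) (edges s) k"
    by (rule interval_model_remove_cover[OF tree(2) finite_verts path])
      (use off_path(2) verts_subtree[OF off_path(1)] edges_subtree[OF off_path(1)] in auto)
  then show "levels_le m s" using levels distinct_verts_subtree[OF tree(1) off_path(1)] by blast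
qed

lemma levels_le_interval_model:
  assumes "distinct_verts t" "interval_model I (verts t) (edges t) (Suc k)"
  shows "levels_le (2 * k) t"
  using assms
proof (induction k arbitrary: t)
  case 0
  obtain a cs where node: "t = Node a cs" by (cases t)
  have False if child: "c \<in> set cs" for c
  proof -
    have "{a, apex c} \<in> edges t" using child node by auto
    then obtain x where common: "x \<in> I a" "x \<in> I (apex c)"
      using "0.prems"(2) unfolding interval_model_def by blast
    have "a \<noteq> apex c" using "0.prems"(1) node child apex_in_verts[of c] by auto
    then have "2 = card {a, apex c}" by simp
    also have "\<dots> \<le> card {v \<in> verts t. x \<in> I v}"
      using common node child by (intro card_mono) (auto simp: bexI[of _ c])
    also have "\<dots> \<le> Suc 0" using "0.prems"(2) unfolding interval_model_def by blast
    finally show False by simp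
  qed
  then have "cs = []" by (cases cs) auto
  then show ?case using node by simp
next
  case (Suc k)
  have "verts t \<noteq> {}" using apex_in_verts[of t] by blast
  then obtain u v where ends_in: "u \<in> verts t" "v \<in> verts t"
    and ends: "\<And>P. u \<in> P \<Longrightarrow> v \<in> P \<Longrightarrow> connected (\<Union>(I ` P)) \<Longrightarrow>
      \<Union>(I ` verts t) \<subseteq> \<Union>(I ` P)"
    using interval_model_ends[OF Suc.prems(2) finite_verts] by blast
  obtain P where path: "bent_path t P" "u \<in> P" "v \<in> P"
    using ex_bent_path_between[OF ends_in] by blast
  have cover: "\<Union>(I ` verts t) \<subseteq> \<Union>(I ` P)"
    using ends path(2,3) connected_Union_bent_path[OF path(1) Suc.prems(2)] .
  have "levels_off_le (2 * k) P t"
    using levels_off_le_cover[OF Suc.prems bent_path_subset_verts[OF path(1)] cover Suc.IH] .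
  then show ?case using levels_le_bent_path[OF path(1) Suc.prems(1)] by simp
qed

lemma levels_le_covering_down_path:
  assumes tree: "distinct_verts t" "interval_model I (verts t) (edges t) (Suc (Suc k))"
    and path: "down_path t P" "\<Union>(I ` verts t) \<subseteq> \<Union>(I ` P)"
  shows "levels_le (Suc (2 * k)) t"
proof (rule levels_le_down_path[OF path(1) tree(1)])
  show "levels_off_le (2 * k) P t"
    using levels_off_le_cover[OF tree down_path_subset_verts[OF path(1)] path(2)]
      levels_le_interval_model .
qed

subsection \<open>Rooting a graph-theoretic tree\<close>

lemma add_leaf:
  assumes "distinct_verts t" "u \<in> verts t" "w \<notin> verts t"
  shows "\<exists>t'. distinct_verts t' \<and> apex t' = apex t \<and> verts t' = insert w (verts t) \<and>
    edges t' = insert {u, w} (edges t)"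
  using assms
proof (induction t)
  case (Node a cs)
  show ?case
  proof (cases "u = a")
    case True
    have "distinct_verts (Node a (Node w [] # cs))"
      using Node.prems by (intro distinct_verts_Cons) (auto simp: disjoint_family_on_def)
    then show ?thesis
      using True by (intro exI[of _ "Node a (Node w [] # cs)"]) auto
  next
    case False
    then obtain c where child: "c \<in> set cs" "u \<in> verts c" using Node.prems(2) by auto
    then obtain c'
      where extended: "distinct_verts c'" "apex c' = apex c" "verts c' = insert w (verts c)"
        "edges c' = insert {u, w} (edges c)"
      using Node.IH[of c] Node.prems by auto
    let ?t = "Node a (c' # removeAll c cs)"
    have "distinct_verts ?t"
    proof (rule distinct_verts_Cons)
      show "distinct_verts (Node a (removeAll c cs))"
        by (rule distinct_verts_subset[OF Node.prems(1)]) auto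
      show "a \<notin> verts c'" using Node.prems(1,3) child(1) extended(3) by auto
      show "verts x \<inter> verts c' = {}" if "x \<in> set (removeAll c cs)" for x
        using distinct_verts_disjoint[OF Node.prems(1) _ child(1), of x] that
          Node.prems(3) extended(3) by auto
    qed (rule extended(1))
    moreover have "verts ?t = insert w (verts (Node a cs))"
      using child(1) by (auto simp: extended(3))
    moreover have "edges ?t = insert {u, w} (edges (Node a cs))"
      using child(1) by (auto simp: extended(2,4))
    ultimately show ?thesis by (metis rtree.sel(1))
  qed
qed

lemma ex_rooted_spanning_tree:
  assumes graph: "finite V" "\<And>u v. {u, v} \<in> E \<Longrightarrow> v \<in> V" "graph_connected V E" and root_in: "a \<in> V"
  shows "\<exists>t. distinct_verts t \<and> apex t = a \<and> verts t = V \<and> edges t \<subseteq> E"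
proof -
  define S where
    "S t \<longleftrightarrow> distinct_verts t \<and> apex t = a \<and> verts t \<subseteq> V \<and> edges t \<subseteq> E" for t
  have "S (Node a [])" using root_in by (simp add: S_def disjoint_family_on_def)
  moreover have "\<forall>t. S t \<longrightarrow> card (verts t) < Suc (card V)"
    using graph(1) by (auto simp: S_def less_Suc_eq_le intro: card_mono)
  ultimately obtain t where feasible: "S t"
    and maximal: "\<And>t'. S t' \<Longrightarrow> card (verts t') \<le> card (verts t)"
    using ex_has_greatest_nat[of S "Node a []" "\<lambda>t. card (verts t)"] by blast
  let ?R = "{(x, y). {x, y} \<in> E}"
  have "y \<in> verts t" if edge: "x \<in> verts t" "{x, y} \<in> E" for x y
  proof (rule ccontr)
    assume new: "y \<notin> verts t"
    obtain t' where "distinct_verts t'" "apex t' = apex t" "verts t' = insert y (verts t)"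
      "edges t' = insert {x, y} (edges t)"
      using add_leaf[OF _ edge(1) new] feasible by (auto simp: S_def)
    then have "S t'" "card (verts t') = Suc (card (verts t))"
      using edge new feasible graph(2) by (auto simp: S_def)
    then show False using maximal[of t'] by simp
  qed
  then have "?R\<^sup>* `` verts t = verts t" by (intro Image_closed_trancl) auto
  moreover have "a \<in> verts t" using feasible apex_in_verts[of t] by (simp add: S_def)
  ultimately have "V \<subseteq> verts t" using graph(3) root_in unfolding graph_connected_def by blast
  then show ?thesis using feasible by (auto simp: S_def)
qed

lemma apex_reaches:
  assumes "v \<in> verts t"
  shows "(apex t, v) \<in> {(x, y). {x, y} \<in> edges t}\<^sup>*"
  using assms
proof (induction t)
  case (Node a cs)
  show ?case
  proof (cases "v = a")
    case False
    then obtain c where child: "c \<in> set cs" "v \<in> verts c" using Node.prems by auto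
    have "{(x, y). {x, y} \<in> edges c} \<subseteq> {(x, y). {x, y} \<in> edges (Node a cs)}"
      using child(1) by auto
    then have "(apex c, v) \<in> {(x, y). {x, y} \<in> edges (Node a cs)}\<^sup>*"
      using Node.IH[OF child] rtrancl_mono by blast
    moreover have "(a, apex c) \<in> {(x, y). {x, y} \<in> edges (Node a cs)}" using child(1) by auto
    ultimately show ?thesis by (simp add: converse_rtrancl_into_rtrancl)
  qed simp
qed

lemma verts_reachable:
  assumes "x \<in> verts t" "y \<in> verts t"
  shows "(x, y) \<in> {(x, y). {x, y} \<in> edges t}\<^sup>*"
proof -
  have "sym ({(x, y). {x, y} \<in> edges t}\<^sup>*)"
    by (rule sym_rtrancl) (auto simp: sym_def insert_commute)
  then show ?thesis
    using apex_reaches[OF assms(1)] apex_reaches[OF assms(2)] by (meson rtrancl_trans symD)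
qed

lemma ex_graph_cycle:
  assumes reach: "(x, y) \<in> {(x, y). {x, y} \<in> F}\<^sup>*" and "x \<noteq> y"
    and closing: "F \<subseteq> E" "{x, y} \<in> E" "{x, y} \<notin> F"
  shows "\<exists>vs. graph_cycle E vs"
proof -
  let ?r = "\<lambda>x y. {x, y} \<in> F"
  obtain ys where "rtrancl_path ?r x ys y"
    using reach by (auto simp flip: rtranclp_rtrancl_eq simp: rtranclp_eq_rtrancl_path)
  then obtain xs where path: "rtrancl_path ?r x xs y" and distinct: "distinct (x # xs)"
    by (rule rtrancl_path_distinct)
  have step: "{(x # xs) ! i, xs ! i} \<in> F" if "i < length xs" for i
    using rtrancl_path_nth[OF path that] .
  have "xs \<noteq> []" using path \<open>x \<noteq> y\<close> by (auto elim: rtrancl_path.cases)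
  then have last: "xs ! (length xs - 1) = y"
    using rtrancl_path_last[OF path] by (simp add: last_conv_nth)
  have "length xs \<noteq> 1" using step[of 0] last closing(3) \<open>xs \<noteq> []\<close> by auto
  then have "3 \<le> length (x # xs)" using \<open>xs \<noteq> []\<close> by (cases xs) (auto simp: Suc_le_eq)
  moreover have "{(x # xs) ! i, (x # xs) ! (Suc i mod length (x # xs))} \<in> E"
    if "i < length (x # xs)" for i
  proof (cases "i = length xs")
    case True
    then show ?thesis using last \<open>xs \<noteq> []\<close> closing(2) by (simp add: nth_Cons' insert_commute)
  next
    case False
    then show ?thesis using that step[of i] closing(1) by auto
  qed
  ultimately have "graph_cycle E (x # xs)" using distinct unfolding graph_cycle_def by blast
  then show ?thesis ..
qed

lemma ex_rooted_tree:
  assumes tree: "graph_tree V E" and root_in: "a \<in> V"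
  shows "\<exists>t. distinct_verts t \<and> apex t = a \<and> verts t = V \<and> edges t = E"
proof -
  have "finite V" and edges_subset: "E \<subseteq> nsets V 2" and "graph_connected V E"
    and acyclic: "\<nexists>vs. graph_cycle E vs"
    using tree unfolding graph_tree_def simple_graph_def by auto
  moreover have "v \<in> V" if "{u, v} \<in> E" for u v
    using subsetD[OF edges_subset that] by (auto simp: nsets_def)
  ultimately obtain t where spanning: "distinct_verts t" "apex t = a" "verts t = V" "edges t \<subseteq> E"
    using ex_rooted_spanning_tree[of V E a] root_in by blast
  have "e \<in> edges t" if edge: "e \<in> E" for e
  proof (rule ccontr)
    assume "e \<notin> edges t"
    moreover obtain x y where "e = {x, y}" "x \<noteq> y" "x \<in> V" "y \<in> V"
      using subsetD[OF edges_subset edge] by (auto elim: nsets2_E)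
    ultimately show False
      using ex_graph_cycle[of x y "edges t" E] verts_reachable[of x t y] spanning edge acyclic
      by auto
  qed
  then show ?thesis using spanning by blast
qed

lemma prolong_down_path:
  assumes distinct: "distinct_verts (Node a cs)" and path: "c \<in> set cs" "down_path c Q"
    and sibling: "e \<in> set cs" "e \<noteq> c"
  shows "\<exists>t'. distinct_verts t' \<and> verts t' = verts (Node a cs) \<and> edges t' = edges (Node a cs) \<and>
    down_path t' (insert (apex e) (insert a Q))"
proof -
  obtain b es where sibling_node: "e = Node b es" by (cases e)
  let ?s = "Node a (removeAll e cs)"
  let ?t = "Node b (?s # es)"
  have set_cs: "set cs = insert e (set cs - {e})" using sibling(1) by auto
  have siblings_disjoint: "verts x \<inter> verts e = {}" if "x \<in> set cs - {e}" for x
    using distinct_verts_disjoint[OF distinct _ sibling(1)] that by auto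
  have rest_disjoint: "verts ?s \<inter> verts e = {}" using siblings_disjoint distinct sibling(1) by auto
  have "distinct_verts ?t"
  proof (rule distinct_verts_Cons)
    show "distinct_verts (Node b es)"
      using distinct sibling(1) unfolding sibling_node distinct_verts.simps(1)[of a] by blast
    show "distinct_verts ?s" by (rule distinct_verts_subset[OF distinct]) auto
    show "b \<notin> verts ?s" using rest_disjoint sibling_node by auto
    show "verts x \<inter> verts ?s = {}" if "x \<in> set es" for x
      using rest_disjoint that sibling_node by auto
  qed
  moreover have "verts ?t = verts (Node a cs)"
    unfolding rtree.set(1)[of a cs] by (subst set_cs) (auto simp: sibling_node)
  moreover have "edges ?t = edges (Node a cs)"
    unfolding edges.simps(1)[of a cs] by (subst set_cs) (auto simp: sibling_node insert_commute)
  moreover have "down_path ?s (insert a Q)" using path sibling(2) by (intro down_step[of c]) auto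
  then have "down_path ?t (insert b (insert a Q))" by (rule down_step[rotated]) simp
  ultimately show ?thesis by (intro exI[of _ ?t]) (auto simp: sibling_node)
qed

lemma down_path_through_child:
  assumes "down_path (Node a cs) P" "cs \<noteq> []"
  obtains c Q where "c \<in> set cs" "down_path c Q" "P \<subseteq> insert a Q"
  using assms(1)
proof cases
  case down_top
  then show ?thesis using that[of "hd cs"] down_path_apex assms(2) by fastforce
next
  case down_step
  then show ?thesis using that by blast
qed

lemma reroot_at_leaf:
  assumes "distinct_verts t" "down_path t P"
  shows "\<exists>t' P'. distinct_verts t' \<and> verts t' = verts t \<and> edges t' = edges t \<and>
    down_path t' P' \<and> P \<subseteq> P' \<and> card (set (children t')) \<le> 1"
  using assms
proof (induction "card (verts t) - card P" arbitrary: t P rule: less_induct)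
  case less
  obtain a cs where node: "t = Node a cs" by (cases t)
  show ?case
  proof (cases "card (set cs) \<le> 1")
    case True
    then show ?thesis using less.prems node by (intro exI[of _ t] exI[of _ P]) auto
  next
    case False
    then obtain c Q where path: "c \<in> set cs" "down_path c Q" "P \<subseteq> insert a Q"
      using down_path_through_child[of a cs P] less.prems(2) node by force
    obtain e where sibling: "e \<in> set cs" "e \<noteq> c"
      using False path(1) by (metis One_nat_def card_le_Suc0_iff_eq finite_set)
    let ?P = "insert (apex e) (insert a Q)"
    obtain t'
      where rerooted: "distinct_verts t'" "verts t' = verts t" "edges t' = edges t"
        "down_path t' ?P"
      using prolong_down_path[OF _ path(1,2) sibling] less.prems(1) node by blast
    have "apex e \<noteq> a" using less.prems(1) node sibling(1) apex_in_verts[of e] by force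
    moreover have "verts e \<inter> Q = {}"
      using distinct_verts_disjoint[OF _ sibling(1) path(1) sibling(2)]
        down_path_subset_verts[OF path(2)] less.prems(1) node by blast
    ultimately have "apex e \<notin> insert a Q" using apex_in_verts[of e] by blast
    then have "P \<subset> ?P" using path(3) by blast
    moreover have "?P \<subseteq> verts t" using down_path_subset_verts[OF rerooted(4)] rerooted(2) by simp
    ultimately have "card P < card ?P" "card ?P \<le> card (verts t)"
      by (auto intro: psubset_card_mono card_mono finite_subset[OF _ finite_verts])
    then have "card (verts t') - card ?P < card (verts t) - card P" using rerooted(2) by simp
    moreover have "P \<subseteq> ?P" using path(3) by blast
    ultimately show ?thesis using less.hyps[OF _ rerooted(1,4)] rerooted(2,3) by (metis order_trans)
  qed
qed

lemma card_child_edges: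
  assumes "distinct_verts (Node a cs)"
  shows "card ((\<lambda>c. {a, apex c}) ` set cs) = card (set cs)"
proof (intro card_image inj_onI, rule ccontr)
  fix x y assume same_edge: "x \<in> set cs" "y \<in> set cs" "{a, apex x} = {a, apex y}" "x \<noteq> y"
  then have "apex x = apex y" by (auto simp: doubleton_eq_iff)
  moreover have "verts x \<inter> verts y = {}"
    using distinct_verts_disjoint[OF assms same_edge(1,2,4)] by simp
  ultimately show False using apex_in_verts[of x] apex_in_verts[of y] by auto
qed

lemma arity_le_if_degree_le:
  assumes "distinct_verts t" "edges t \<subseteq> E" "finite E"
    and "\<And>v. v \<in> verts t \<Longrightarrow> vertex_degree E v \<le> Suc d"
    and "{p, apex t} \<in> E" "p \<notin> verts t"
  shows "arity_le d t"
  using assms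
proof (induction t arbitrary: p)
  case (Node a cs)
  let ?F = "(\<lambda>c. {a, apex c}) ` set cs"
  have "p \<noteq> apex c" if "c \<in> set cs" for c using Node.prems(6) that by auto
  then have "{p, a} \<notin> ?F" using Node.prems(6) by (auto simp: doubleton_eq_iff)
  then have "Suc (card (set cs)) = card (insert {p, a} ?F)"
    using card_child_edges[OF Node.prems(1)] by simp
  also have "\<dots> \<le> vertex_degree E a"
    unfolding vertex_degree_def by (rule card_mono) (use Node.prems in auto)
  also have "\<dots> \<le> Suc d" using Node.prems(4) by simp
  finally have "card (set cs) \<le> d" by simp
  moreover have "arity_le d c" if "c \<in> set cs" for c
    using that Node.prems by (intro Node.IH[where p = a]) auto
  ultimately show ?case by simp
qed

lemma arity_le_max_degree:
  assumes "distinct_verts t" "card (set (children t)) \<le> 1"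
  shows "arity_le (max (max_degree (verts t) (edges t) - 1) 1) t"
proof -
  obtain a cs where node: "t = Node a cs" by (cases t)
  have "finite (edges t)"
    using edges_subset_verts by (intro finite_subset[of "edges t" "Pow (verts t)"]) auto
  moreover have "vertex_degree (edges t) v \<le> Suc (max (max_degree (verts t) (edges t) - 1) 1)"
    if "v \<in> verts t" for v
  proof -
    have "vertex_degree (edges t) v \<le> max_degree (verts t) (edges t)"
      unfolding max_degree_def using that by (intro Max_ge) auto
    then show ?thesis by simp
  qed
  ultimately have "arity_le (max (max_degree (verts t) (edges t) - 1) 1) c" if "c \<in> set cs" for c
    using that assms(1) node by (intro arity_le_if_degree_le[of c "edges t" _ a]) auto
  then show ?thesis using assms(2) node by simp
qed

lemma ex_low_level_rooting:
  assumes tree: "graph_tree V E" and width: "pathwidth V E = Suc k"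
  shows "\<exists>t. distinct_verts t \<and> verts t = V \<and> edges t = E \<and>
    arity_le (max (max_degree V E - 1) 1) t \<and> levels_le (Suc (2 * k)) t"
proof -
  have fin_nonempty: "finite V" "V \<noteq> {}" and simple: "simple_graph V E"
    using tree unfolding graph_tree_def simple_graph_def graph_connected_def by auto
  obtain I where model: "interval_model I V E (Suc (Suc k))"
    using ex_interval_model_pathwidth[OF simple] width by auto
  obtain u v where ends_in: "u \<in> V" "v \<in> V"
    and ends: "\<And>P. u \<in> P \<Longrightarrow> v \<in> P \<Longrightarrow> connected (\<Union>(I ` P)) \<Longrightarrow>
      \<Union>(I ` V) \<subseteq> \<Union>(I ` P)"
    using interval_model_ends[OF model fin_nonempty] by blast
  obtain s where rooted: "distinct_verts s" "apex s = u" "verts s = V" "edges s = E"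
    using ex_rooted_tree[OF tree ends_in(1)] by blast
  obtain P where path: "down_path s P" "v \<in> P"
    using ex_down_path_to[of v s] ends_in(2) rooted(3) by blast
  have "u \<in> P" using apex_in_down_path[OF path(1)] rooted(2) by simp
  then have cover: "\<Union>(I ` V) \<subseteq> \<Union>(I ` P)"
    using ends path connected_Union_down_path[OF path(1)] model rooted(3,4) by blast
  obtain t Q
    where rerooted: "distinct_verts t" "verts t = V" "edges t = E" "card (set (children t)) \<le> 1"
    and longer: "down_path t Q" "P \<subseteq> Q"
    using reroot_at_leaf[OF rooted(1) path(1)] rooted(3,4) by blast
  have "\<Union>(I ` verts t) \<subseteq> \<Union>(I ` Q)" using cover longer(2) rerooted(2) by blast
  then have "levels_le (Suc (2 * k)) t"
    using levels_le_covering_down_path[OF rerooted(1) _ longer(1)] model rerooted(2,3) by simp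
  then show ?thesis using arity_le_max_degree[OF rerooted(1,4)] rerooted by blast
qed

subsection \<open>Noncrossing drawings\<close>

text \<open>A drawing is viewed as a geometric complex whose faces are the vertices, as singletons, and
  the edges, so that plane and straight-line drawings are covered by the single condition that the
  hulls of two faces meet only in common vertices.\<close>

definition faces :: "'a set \<Rightarrow> 'a set set \<Rightarrow> 'a set set" where
  "faces V E = (\<lambda>v. {v}) ` V \<union> E"

definition noncrossing :: "'a set set \<Rightarrow> ('a \<Rightarrow> 'b::real_vector) \<Rightarrow> bool" where
  "noncrossing F p \<longleftrightarrow>
     (\<forall>e\<in>F. \<forall>f\<in>F. e \<noteq> f \<longrightarrow> convex hull (p ` e) \<inter> convex hull (p ` f) \<subseteq> p ` (e \<inter> f))"

lemma noncrossingD: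
  assumes "noncrossing F p" "e \<in> F" "f \<in> F" "e \<noteq> f"
  shows "convex hull (p ` e) \<inter> convex hull (p ` f) \<subseteq> p ` (e \<inter> f)"
  using assms unfolding noncrossing_def by blast

lemma noncrossing_vertex_in_face:
  assumes "noncrossing F p" "{v} \<in> F" "e \<in> F" "p v \<in> convex hull (p ` e)"
  shows "v \<in> e"
  using noncrossingD[OF assms(1-3)] assms(4) by (cases "e = {v}") auto

lemma plane_drawing_if_noncrossing:
  assumes "noncrossing (faces V E) p"
  shows "plane_drawing V E p"
proof -
  have vertex: "w \<in> e" if "w \<in> V" "e \<in> faces V E" "p w \<in> convex hull (p ` e)" for w e
    using noncrossing_vertex_in_face[OF assms _ that(2,3)] that(1) by (simp add: faces_def)
  have "inj_on p V"
  proof (rule inj_onI)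
    fix v w assume "v \<in> V" "w \<in> V" "p v = p w"
    then show "v = w" using vertex[of v "{w}"] by (simp add: faces_def)
  qed
  moreover have "w \<in> {u, v}"
    if "{u, v} \<in> E" "w \<in> V" "p w \<in> closed_segment (p u) (p v)" for u v w
    using vertex[of w "{u, v}"] that by (simp add: faces_def segment_convex_hull)
  moreover have "closed_segment (p u) (p v) \<inter> closed_segment (p x) (p y) \<subseteq> p ` ({u, v} \<inter> {x, y})"
    if "{u, v} \<in> E" "{x, y} \<in> E" "{u, v} \<noteq> {x, y}" for u v x y
    using noncrossingD[OF assms, of "{u, v}" "{x, y}"] that
    by (simp add: faces_def segment_convex_hull del: Int_insert_left Int_insert_right)
  ultimately show ?thesis unfolding plane_drawing_def straight_line_drawing_def by blast
qed

lemma noncrossing_translate: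
  assumes noncrossing: "noncrossing F q" and translate: "\<And>v. v \<in> \<Union>F \<Longrightarrow> p v = z + q v"
  shows "noncrossing F p"
  unfolding noncrossing_def
proof (intro ballI impI)
  have image: "p ` e = (+) z ` q ` e" if "e \<subseteq> \<Union>F" for e
    using translate that by (auto simp: image_iff subset_iff)
  fix e f assume distinct_faces: "e \<in> F" "f \<in> F" "e \<noteq> f"
  then have in_faces: "e \<subseteq> \<Union>F" "f \<subseteq> \<Union>F" "e \<inter> f \<subseteq> \<Union>F" by auto
  have "convex hull (p ` e) \<inter> convex hull (p ` f) =
      (+) z ` (convex hull (q ` e) \<inter> convex hull (q ` f))"
    unfolding image[OF in_faces(1)] image[OF in_faces(2)] convex_hull_translation
    by (simp add: image_Int)
  also have "\<dots> \<subseteq> (+) z ` q ` (e \<inter> f)"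
    using noncrossingD[OF noncrossing distinct_faces] by (rule image_mono)
  also have "\<dots> = p ` (e \<inter> f)" using image[OF in_faces(3)] by simp
  finally show "convex hull (p ` e) \<inter> convex hull (p ` f) \<subseteq> p ` (e \<inter> f)" .
qed

lemma hulls_meet_in_common_vertex:
  assumes "noncrossing F p" "{a} \<in> F" "e \<in> F" and "noncrossing G p" "{a} \<in> G" "f \<in> G"
    and meet: "convex hull (p ` e) \<inter> convex hull (p ` f) \<subseteq> {p a}"
  shows "convex hull (p ` e) \<inter> convex hull (p ` f) \<subseteq> p ` (e \<inter> f)"
  using meet noncrossing_vertex_in_face[OF assms(1-3)] noncrossing_vertex_in_face[OF assms(4-6)]
  by blast

lemma noncrossing_UN:
  assumes noncrossing: "\<And>i. i \<in> I \<Longrightarrow> noncrossing (F i) p" and common: "\<And>i. i \<in> I \<Longrightarrow> {a} \<in> F i"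
    and meet: "\<And>i j e f. i \<in> I \<Longrightarrow> j \<in> I \<Longrightarrow> i \<noteq> j \<Longrightarrow> e \<in> F i \<Longrightarrow> f \<in> F j \<Longrightarrow>
      convex hull (p ` e) \<inter> convex hull (p ` f) \<subseteq> {p a}"
  shows "noncrossing (\<Union>i\<in>I. F i) p"
  unfolding noncrossing_def
proof (intro ballI impI)
  fix e f assume "e \<in> (\<Union>i\<in>I. F i)" "f \<in> (\<Union>i\<in>I. F i)" "e \<noteq> f"
  then obtain i j where members: "i \<in> I" "e \<in> F i" "j \<in> I" "f \<in> F j" by blast
  show "convex hull (p ` e) \<inter> convex hull (p ` f) \<subseteq> p ` (e \<inter> f)"
  proof (cases "i = j")
    case True
    then show ?thesis using noncrossingD[OF noncrossing] members \<open>e \<noteq> f\<close> by blast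
  next
    case False
    show ?thesis
      using hulls_meet_in_common_vertex[OF noncrossing common members(2) noncrossing common]
        meet[OF members(1,3) False members(2,4)] members by blast
  qed
qed

lemma noncrossing_insert_pendant:
  assumes noncrossing: "noncrossing F p" "{b} \<in> F" and "p a \<noteq> p b"
    and meet: "\<And>e. e \<in> F \<Longrightarrow> convex hull (p ` e) \<inter> closed_segment (p a) (p b) \<subseteq> {p b}"
  shows "noncrossing (insert {a} (insert {a, b} F)) p"
proof -
  define G where "G i = (if i then F else {{a}, {b}, {a, b}})" for i
  have edge: "noncrossing {{a}, {b}, {a, b}} p"
    using \<open>p a \<noteq> p b\<close> by (auto simp: noncrossing_def)
  have segment: "convex hull (p ` f) \<subseteq> closed_segment (p a) (p b)" if "f \<in> {{a}, {b}, {a, b}}" for f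
    using that unfolding segment_convex_hull by (intro hull_mono) auto
  have "noncrossing (\<Union>i\<in>UNIV. G i) p"
  proof (rule noncrossing_UN[where a = b])
    show "noncrossing (G i) p" "{b} \<in> G i" for i using noncrossing edge by (simp_all add: G_def)
    show "convex hull (p ` e) \<inter> convex hull (p ` f) \<subseteq> {p b}"
      if "i \<noteq> j" "e \<in> G i" "f \<in> G j" for i j e f
      using that meet[of e] meet[of f] segment[of e] segment[of f]
      unfolding G_def by (cases i; cases j) auto
  qed
  moreover have "(\<Union>i\<in>UNIV. G i) = insert {a} (insert {a, b} F)"
    using noncrossing(2) by (auto simp: G_def UNIV_bool)
  ultimately show ?thesis by simp
qed

lemma closed_segment_Int_halfspace:
  fixes a b c :: "'a::real_inner"
  assumes "c \<bullet> a < c \<bullet> b"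
  shows "closed_segment a b \<inter> {x. c \<bullet> b \<le> c \<bullet> x} \<subseteq> {b}"
proof
  fix x assume meet: "x \<in> closed_segment a b \<inter> {x. c \<bullet> b \<le> c \<bullet> x}"
  then obtain t where combination: "0 \<le> t" "t \<le> 1" "x = (1 - t) *\<^sub>R a + t *\<^sub>R b"
    by (auto simp: in_segment)
  have "(1 - t) * (c \<bullet> b - c \<bullet> a) \<le> 0"
    using meet combination(3) by (simp add: inner_simps algebra_simps)
  then have "t = 1" using assms combination(2) by (auto simp: mult_le_0_iff)
  then show "x \<in> {b}" using combination(3) by simp
qed

definition branch :: "'a \<Rightarrow> 'a rtree \<Rightarrow> 'a set set" where
  "branch a c = insert {a} (insert {a, apex c} (faces (verts c) (edges c)))"

lemma faces_Node:
  assumes "cs \<noteq> []"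
  shows "faces (verts (Node a cs)) (edges (Node a cs)) = (\<Union>c\<in>set cs. branch a c)"
  using assms by (cases cs) (auto simp: faces_def branch_def)

lemma face_subset_verts: "e \<in> faces (verts t) (edges t) \<Longrightarrow> e \<subseteq> verts t"
  using edges_subset_verts[of e t] by (auto simp: faces_def)

lemma noncrossing_branch:
  assumes subdrawing: "noncrossing (faces (verts c) (edges c)) q" "q (apex c) = 0"
      "\<And>v. v \<in> verts c \<Longrightarrow> 0 \<le> Re (q v)"
    and right: "0 < Re z" and translate: "p a = 0" "\<And>v. v \<in> verts c \<Longrightarrow> p v = z + q v"
  shows "noncrossing (branch a c) p"
  unfolding branch_def
proof (rule noncrossing_insert_pendant)
  have tip: "p (apex c) = z" using translate(2)[OF apex_in_verts] subdrawing(2) by simp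
  show "noncrossing (faces (verts c) (edges c)) p"
    by (rule noncrossing_translate[OF subdrawing(1)]) (use face_subset_verts translate(2) in blast)
  show "{apex c} \<in> faces (verts c) (edges c)" by (simp add: faces_def)
  show "p a \<noteq> p (apex c)" using right translate(1) tip by auto
  fix e assume "e \<in> faces (verts c) (edges c)"
  then have "e \<subseteq> verts c" by (rule face_subset_verts)
  then have "convex hull (p ` e) \<subseteq> {w. Re z \<le> Re w}"
    using translate(2) subdrawing(3)
    by (intro hull_minimal convex_halfspace_Re_ge) (auto simp: subset_iff)
  then show "convex hull (p ` e) \<inter> closed_segment (p a) (p (apex c)) \<subseteq> {p (apex c)}"
    using closed_segment_Int_halfspace[of 1 0 z] right unfolding tip translate(1) by auto
qed

lemma ex_inj_on_to_lessThan_zero_at: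
  assumes "finite S" "card S \<le> d" "h \<in> S"
  shows "\<exists>i. inj_on i S \<and> i ` S \<subseteq> {..<d} \<and> i h = (0::nat)"
proof -
  obtain g where enumeration: "bij_betw g (S - {h}) {0..<card (S - {h})}"
    using ex_bij_betw_finite_nat[of "S - {h}"] assms(1) by blast
  define i where "i x = (if x = h then 0 else Suc (g x))" for x
  have "inj_on i S"
    using enumeration by (auto simp: i_def inj_on_def bij_betw_def)
  moreover have "i x < d" if "x \<in> S" for x
  proof (cases "x = h")
    case True
    then show ?thesis using assms card_gt_0_iff[of S] by (auto simp: i_def)
  next
    case False
    then have "g x < card S - 1" using bij_betwE[OF enumeration] that assms(1,3) by simp
    then show ?thesis using False assms(2) by (simp add: i_def)
  qed
  moreover have "i h = 0" by (simp add: i_def)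
  ultimately show ?thesis by blast
qed

lemma ex_function_on_disjoint_family:
  assumes "disjoint_family_on A S"
  shows "\<exists>f. \<forall>i\<in>S. \<forall>x\<in>A i. f x = g i x"
proof (intro exI ballI)
  fix i x assume member: "i \<in> S" "x \<in> A i"
  have "(THE i. i \<in> S \<and> x \<in> A i) = i"
    by (rule the_equality) (use member assms in \<open>auto dest: disjoint_family_onD\<close>)
  then show "g (THE i. i \<in> S \<and> x \<in> A i) x = g i x" by simp
qed

subsection \<open>Directions and sectors\<close>

lemma slope_eq_if_parallel:
  assumes "b - a = of_real c * (b' - a')" "c \<noteq> 0"
  shows "slope a b = slope a' b'"
proof -
  have "(\<exists>r::real. b - a = of_real r * cis \<theta>) \<longleftrightarrow> (\<exists>r::real. b' - a' = of_real r * cis \<theta>)" for \<theta>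
  proof
    assume "\<exists>r::real. b - a = of_real r * cis \<theta>"
    then obtain r :: real where "of_real c * (b' - a') = of_real r * cis \<theta>" using assms(1) by auto
    then have "b' - a' = of_real (r / c) * cis \<theta>" using assms(2) by (simp add: field_simps)
    then show "\<exists>r::real. b' - a' = of_real r * cis \<theta>" ..
  next
    assume "\<exists>r::real. b' - a' = of_real r * cis \<theta>"
    then obtain r :: real where "b' - a' = of_real r * cis \<theta>" ..
    then have "b - a = of_real (c * r) * cis \<theta>" using assms(1) by simp
    then show "\<exists>r::real. b - a = of_real r * cis \<theta>" ..
  qed
  then show ?thesis unfolding slope_def by simp
qed

text \<open>An edge at level \<open>m\<close> has length \<open>B ^ m\<close>, so a tree on at most \<open>n\<close> vertices drawn at
  level \<open>m - 1\<close> fits into a disc of radius \<open>\<epsilon> * B ^ m\<close>.\<close>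

locale directions =
  fixes d n :: nat and u :: "nat \<Rightarrow> complex" and \<epsilon> B :: real
  assumes u_0: "u 0 = 1"
    and norm_u: "\<And>i. i < d \<Longrightarrow> cmod (u i) = 1"
    and Re_u_pos: "\<And>i. i < d \<Longrightarrow> 0 < Re (u i)"
    and Re_u_le: "\<And>i. 0 < i \<Longrightarrow> i < d \<Longrightarrow> Re (u i) \<le> 1/2"
    and u_separated: "\<And>i j. i < d \<Longrightarrow> j < d \<Longrightarrow> i \<noteq> j \<Longrightarrow> 4 * \<epsilon> < \<bar>Im (cnj (u i) * u j)\<bar>"
    and eps: "0 < \<epsilon>" "\<epsilon> < 1/2"
    and B_ge: "1 \<le> B" "real n \<le> \<epsilon> * B"
begin

text \<open>For a unit vector \<open>u i\<close>, \<open>\<bar>Im (cnj (u i) * w)\<bar>\<close> is the distance of \<open>w\<close> from the line spanned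
  by \<open>u i\<close>.\<close>

definition wedge :: "nat \<Rightarrow> complex set" where
  "wedge i = {w. \<bar>Im (cnj (u i) * w)\<bar> \<le> 2 * \<epsilon> * cmod w}"

lemma wedge_Int:
  assumes "i < d" "j < d" "i \<noteq> j"
  shows "wedge i \<inter> wedge j \<subseteq> {0}"
proof
  fix w assume in_wedges: "w \<in> wedge i \<inter> wedge j"
  \<comment> \<open>Cramer's rule for the coordinates of \<open>w\<close> with respect to \<open>u i\<close> and \<open>u j\<close>\<close>
  have "of_real (Im (cnj (u i) * u j)) * w =
      of_real (Im (cnj (u i) * w)) * u j - of_real (Im (cnj (u j) * w)) * u i"
    by (simp add: complex_eq_iff algebra_simps)
  then have "\<bar>Im (cnj (u i) * u j)\<bar> * cmod w =
      cmod (of_real (Im (cnj (u i) * w)) * u j - of_real (Im (cnj (u j) * w)) * u i)"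
    by (metis norm_mult norm_of_real)
  also have "\<dots> \<le> cmod (of_real (Im (cnj (u i) * w)) * u j) +
      cmod (of_real (Im (cnj (u j) * w)) * u i)"
    by (rule norm_triangle_ineq4)
  also have "\<dots> \<le> 4 * \<epsilon> * cmod w"
    using in_wedges norm_u[OF assms(1)] norm_u[OF assms(2)]
    unfolding wedge_def norm_mult norm_of_real by simp
  finally show "w \<in> {0}"
    using u_separated[OF assms] by (auto simp: mult_le_cancel_right)
qed

lemma closed_segment_subset_wedge: "closed_segment 0 (of_real L * u i) \<subseteq> wedge i"
  using eps by (auto simp: in_segment wedge_def scaleR_conv_of_real algebra_simps)

lemma cball_subset_wedge:
  assumes "0 < L" "i < d"
  shows "cball (of_real L * u i) (\<epsilon> * L) \<subseteq> wedge i"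
proof
  fix w assume "w \<in> cball (of_real L * u i) (\<epsilon> * L)"
  then have close: "cmod (w - of_real L * u i) \<le> \<epsilon> * L" by (simp add: dist_norm norm_minus_commute)
  have "Im (cnj (u i) * w) = Im (cnj (u i) * (w - of_real L * u i))" by (simp add: algebra_simps)
  then have "\<bar>Im (cnj (u i) * w)\<bar> \<le> \<epsilon> * L"
    using abs_Im_le_cmod[of "cnj (u i) * (w - of_real L * u i)"] close norm_u[OF assms(2)]
    by (simp add: norm_mult)
  moreover have half: "\<epsilon> * L \<le> 1/2 * L" using eps assms(1) by (intro mult_right_mono) auto
  have "L - cmod w \<le> \<epsilon> * L"
    using norm_triangle_ineq2[of "of_real L * u i" w] close norm_u[OF assms(2)] assms(1)
    by (simp add: norm_mult norm_minus_commute)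
  then have "1/2 * L \<le> cmod w" using half by linarith
  then have "2 * \<epsilon> * (1/2 * L) \<le> 2 * \<epsilon> * cmod w" using eps by (intro mult_left_mono) auto
  ultimately show "w \<in> wedge i" by (simp add: wedge_def)
qed

text \<open>The heavy subtree occupies the half-plane beyond the tip of its edge, and all other subtrees stay
  outside of it.\<close>

definition sector :: "real \<Rightarrow> nat \<Rightarrow> complex set" where
  "sector L i = (if i = 0 then wedge 0 \<union> {w. L \<le> Re w} else wedge i \<inter> {w. Re w < L})"

lemma sector_Int:
  assumes "i < d" "j < d" "i \<noteq> j"
  shows "sector L i \<inter> sector L j \<subseteq> {0}"
  using wedge_Int[OF assms] assms(3) by (auto simp: sector_def)

lemma Re_cball_less:
  assumes "0 < L" "0 < i" "i < d" "w \<in> cball (of_real L * u i) (\<epsilon> * L)"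
  shows "Re w < L"
proof -
  have "Re w - L * Re (u i) \<le> \<epsilon> * L"
    using complex_Re_le_cmod[of "w - of_real L * u i"] assms(4)
    by (simp add: dist_norm norm_minus_commute)
  moreover have "L * Re (u i) \<le> L * (1/2)"
    using assms(1) Re_u_le[OF assms(2,3)] by (intro mult_left_mono) auto
  moreover have "\<epsilon> * L < 1/2 * L" using assms(1) eps by (intro mult_strict_right_mono) auto
  ultimately show ?thesis by simp
qed

lemma cball_subset_sector:
  assumes "0 < L" "0 < i" "i < d"
  shows "cball (of_real L * u i) (\<epsilon> * L) \<subseteq> sector L i"
  using cball_subset_wedge[OF assms(1,3)] Re_cball_less[OF assms] assms(2)
  by (auto simp: sector_def)

lemma closed_segment_subset_sector:
  assumes "0 < L" "i < d"
  shows "closed_segment 0 (of_real L * u i) \<subseteq> sector L i"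
proof (cases "i = 0")
  case True
  then show ?thesis using closed_segment_subset_wedge by (auto simp: sector_def)
next
  case False
  have "of_real L * u i \<in> cball (of_real L * u i) (\<epsilon> * L)" using assms(1) eps by simp
  then have "Re (of_real L * u i) < L" using Re_cball_less assms False by blast
  then have "closed_segment 0 (of_real L * u i) \<subseteq> {w. Re w < L}"
    using assms(1) by (intro closed_segment_subset convex_halfspace_Re_lt) auto
  then show ?thesis using closed_segment_subset_wedge False by (auto simp: sector_def)
qed

subsection \<open>Drawing a tree with few levels\<close>

definition steps :: "nat \<Rightarrow> complex set" where
  "steps m = (\<lambda>(i, j). of_real (B ^ j) * u i) ` ({..<d} \<times> {1..m})"

definition drawn :: "nat \<Rightarrow> 'a rtree \<Rightarrow> ('a \<Rightarrow> complex) \<Rightarrow> bool" where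
  "drawn m t p \<longleftrightarrow> p (apex t) = 0 \<and> noncrossing (faces (verts t) (edges t)) p \<and>
     (\<forall>v\<in>verts t. 0 \<le> Re (p v) \<and> cmod (p v) \<le> real (card (verts t)) * B ^ m) \<and>
     (\<forall>e\<in>edges t. \<exists>x y. e = {x, y} \<and> p y - p x \<in> steps m)"

lemma steps_mono: "m \<le> k \<Longrightarrow> steps m \<subseteq> steps k"
  unfolding steps_def by (intro image_mono) auto

lemma drawn_mono:
  assumes "drawn m t p" "m \<le> k"
  shows "drawn k t p"
proof -
  have "real (card (verts t)) * B ^ m \<le> real (card (verts t)) * B ^ k"
    using B_ge(1) assms(2) by (intro mult_left_mono power_increasing) auto
  then show ?thesis
    using assms(1) steps_mono[OF assms(2)] unfolding drawn_def
    by (meson le_trans order_trans subsetD)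
qed

lemma drawn_leaf: "drawn m (Node a []) (\<lambda>_. 0)"
  using B_ge(1) by (simp add: drawn_def noncrossing_def faces_def)

text \<open>Direction \<open>0\<close> is reserved for the heavy child.\<close>

definition attached :: "nat \<Rightarrow> 'a \<Rightarrow> 'a rtree \<Rightarrow> nat \<Rightarrow> ('a \<Rightarrow> complex) \<Rightarrow> bool" where
  "attached m a c i p \<longleftrightarrow> i < d \<and> p a = 0 \<and>
     (\<exists>q. drawn (if i = 0 then Suc m else m) c q \<and>
       (\<forall>v\<in>verts c. p v = of_real (B ^ Suc m) * u i + q v))"

lemma attachedE:
  assumes "attached m a c i p"
  obtains q where "drawn (if i = 0 then Suc m else m) c q" "drawn (Suc m) c q"
    "\<And>v. v \<in> verts c \<Longrightarrow> p v = of_real (B ^ Suc m) * u i + q v"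
    "p (apex c) = of_real (B ^ Suc m) * u i" "p a = 0" "i < d"
proof -
  obtain q where subdrawing: "drawn (if i = 0 then Suc m else m) c q" "i < d" "p a = 0"
    and translate: "\<And>v. v \<in> verts c \<Longrightarrow> p v = of_real (B ^ Suc m) * u i + q v"
    using assms unfolding attached_def by blast
  show thesis
  proof (rule that[OF subdrawing(1) _ translate _ subdrawing(3,2)])
    show "drawn (Suc m) c q" using drawn_mono[OF subdrawing(1)] by (simp split: if_splits)
    show "p (apex c) = of_real (B ^ Suc m) * u i"
      using translate[OF apex_in_verts] subdrawing(1) by (simp add: drawn_def)
  qed
qed

lemma attached_noncrossing:
  assumes "attached m a c i p"
  shows "noncrossing (branch a c) p"
  using assms
proof (rule attachedE)
  fix q
  assume "drawn (Suc m) c q" "i < d" "p a = 0"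
    "\<And>v. v \<in> verts c \<Longrightarrow> p v = of_real (B ^ Suc m) * u i + q v"
  moreover have "0 < Re (of_real (B ^ Suc m) * u i)"
    using B_ge(1) Re_u_pos[OF \<open>i < d\<close>] by (simp del: power_Suc)
  ultimately show ?thesis
    by (intro noncrossing_branch[where z = "of_real (B ^ Suc m) * u i"]) (auto simp: drawn_def)
qed

lemma attached_hull_subset_sector:
  assumes "attached m a c i p" and small: "card (verts c) \<le> n" and face: "e \<in> branch a c"
  shows "convex hull (p ` e) \<subseteq> sector (B ^ Suc m) i"
proof -
  define L where "L = B ^ Suc m"
  have L_pos: "0 < L" using B_ge(1) by (simp add: L_def)
  obtain q where subdrawing: "drawn (if i = 0 then Suc m else m) c q"
    and position: "\<And>v. v \<in> verts c \<Longrightarrow> p v = of_real L * u i + q v"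
      "p (apex c) = of_real L * u i" "p a = 0" and less: "i < d"
    using assms(1) unfolding L_def by (rule attachedE) blast
  consider (edge) "e \<subseteq> {a, apex c}" | (heavy) "e \<subseteq> verts c" "i = 0" | (light) "e \<subseteq> verts c" "0 < i"
    using face face_subset_verts[of e c] by (auto simp: branch_def)
  then have "convex hull (p ` e) \<subseteq> sector L i"
  proof cases
    case edge
    then have "convex hull (p ` e) \<subseteq> closed_segment (p a) (p (apex c))"
      unfolding segment_convex_hull by (intro hull_mono) auto
    then show ?thesis using closed_segment_subset_sector[OF L_pos less] position(2,3) by auto
  next
    case heavy
    have "L \<le> Re (p v)" if "v \<in> verts c" for v
      using position(1)[OF that] subdrawing that heavy(2) u_0 by (simp add: drawn_def)
    then have "convex hull (p ` e) \<subseteq> {w. L \<le> Re w}"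
      using heavy(1) by (intro hull_minimal convex_halfspace_Re_ge) auto
    then show ?thesis using heavy(2) by (auto simp: sector_def)
  next
    case light
    have "p v \<in> cball (of_real L * u i) (\<epsilon> * L)" if vertex: "v \<in> verts c" for v
    proof -
      have "cmod (q v) \<le> real (card (verts c)) * B ^ m"
        using subdrawing vertex light(2) by (simp add: drawn_def)
      also have "\<dots> \<le> (\<epsilon> * B) * B ^ m" using small B_ge by (intro mult_right_mono) auto
      finally show ?thesis using position(1)[OF vertex] by (simp add: dist_norm L_def mult.assoc)
    qed
    then have "convex hull (p ` e) \<subseteq> cball (of_real L * u i) (\<epsilon> * L)"
      using light(1) by (intro hull_minimal) auto
    then show ?thesis using cball_subset_sector[OF L_pos light(2) less] by blast
  qed
  then show ?thesis by (simp add: L_def)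
qed

lemma attached_bounds:
  assumes "attached m a c i p" and vertex: "v \<in> verts c"
  shows "0 \<le> Re (p v)" "cmod (p v) \<le> real (card (verts c) + 1) * B ^ Suc m"
proof -
  define L where "L = B ^ Suc m"
  have L_pos: "0 < L" using B_ge(1) by (simp add: L_def)
  obtain q where subdrawing: "drawn (Suc m) c q" and translate: "p v = of_real L * u i + q v"
    and less: "i < d"
    using assms(1) by (rule attachedE) (use vertex in \<open>auto simp: L_def\<close>)
  have sub_bounds: "0 \<le> Re (q v)" "cmod (q v) \<le> real (card (verts c)) * L"
    using subdrawing vertex by (auto simp: drawn_def L_def)
  then show "0 \<le> Re (p v)" using translate L_pos Re_u_pos[OF less] by simp
  have "cmod (p v) \<le> cmod (of_real L * u i) + cmod (q v)"
    unfolding translate by (rule norm_triangle_ineq)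
  also have "\<dots> \<le> real (card (verts c) + 1) * L"
    using sub_bounds(2) norm_u[OF less] L_pos by (simp add: norm_mult algebra_simps)
  finally show "cmod (p v) \<le> real (card (verts c) + 1) * B ^ Suc m" by (simp add: L_def)
qed

lemma attached_steps:
  assumes "attached m a c i p" and "e = {a, apex c} \<or> e \<in> edges c"
  shows "\<exists>x y. e = {x, y} \<and> p y - p x \<in> steps (Suc m)"
proof -
  obtain q where subdrawing: "drawn (Suc m) c q"
    and position: "\<And>v. v \<in> verts c \<Longrightarrow> p v = of_real (B ^ Suc m) * u i + q v"
      "p (apex c) = of_real (B ^ Suc m) * u i" "p a = 0" and less: "i < d"
    using assms(1) by (rule attachedE) blast
  show ?thesis
    using assms(2)
  proof
    assume "e = {a, apex c}"
    moreover have "of_real (B ^ Suc m) * u i \<in> steps (Suc m)"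
      unfolding steps_def using less by (intro image_eqI[of _ _ "(i, Suc m)"]) auto
    then have "p (apex c) - p a \<in> steps (Suc m)" by (simp add: position(2,3))
    ultimately show ?thesis by blast
  next
    assume inner: "e \<in> edges c"
    then obtain x y where step: "e = {x, y}" "q y - q x \<in> steps (Suc m)"
      using subdrawing unfolding drawn_def by blast
    moreover have "p y - p x = q y - q x"
      using position(1) edges_subset_verts[OF inner] step(1) by simp
    ultimately show ?thesis by metis
  qed
qed

lemma noncrossing_Node:
  assumes "cs \<noteq> []" "inj_on i (set cs)"
    and attached: "\<And>c. c \<in> set cs \<Longrightarrow> attached m a c (i c) p"
    and card: "\<And>c. c \<in> set cs \<Longrightarrow> card (verts c) \<le> n"
  shows "noncrossing (faces (verts (Node a cs)) (edges (Node a cs))) p"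
  unfolding faces_Node[OF assms(1)]
proof (rule noncrossing_UN[where a = a])
  show "noncrossing (branch a c) p" if "c \<in> set cs" for c
    using attached_noncrossing[OF attached[OF that]] .
  show "{a} \<in> branch a c" for c by (simp add: branch_def)
  fix c c' e e'
  assume children: "c \<in> set cs" "c' \<in> set cs" "c \<noteq> c'"
    and face: "e \<in> branch a c" "e' \<in> branch a c'"
  have less: "i c < d" "i c' < d" and apex: "p a = 0"
    using attached children unfolding attached_def by auto
  have "convex hull (p ` e) \<inter> convex hull (p ` e') \<subseteq>
      sector (B ^ Suc m) (i c) \<inter> sector (B ^ Suc m) (i c')"
    using attached_hull_subset_sector[OF attached card] children face by (intro Int_mono) auto
  also have "\<dots> \<subseteq> {0}"
    by (rule sector_Int[OF less inj_on_contraD[OF assms(2) children(3,1,2)]])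
  finally show "convex hull (p ` e) \<inter> convex hull (p ` e') \<subseteq> {p a}" by (simp add: apex)
qed

lemma drawn_Node:
  assumes distinct: "distinct_verts (Node a cs)" and card: "card (verts (Node a cs)) \<le> n"
    and nonempty: "cs \<noteq> []" and inj: "inj_on i (set cs)"
    and attached: "\<And>c. c \<in> set cs \<Longrightarrow> attached m a c (i c) p"
  shows "drawn (Suc m) (Node a cs) p"
proof -
  have apex: "p a = 0"
    using attached[OF hd_in_set[OF nonempty]] unfolding attached_def by blast
  note card_less = card_verts_child_less[OF distinct]
  have "card (verts c) \<le> n" if "c \<in> set cs" for c using card_less[OF that] card by simp
  then have "noncrossing (faces (verts (Node a cs)) (edges (Node a cs))) p"
    using noncrossing_Node[OF nonempty inj attached] by simp
  moreover have "0 \<le> Re (p v) \<and> cmod (p v) \<le> real (card (verts (Node a cs))) * B ^ Suc m"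
    if "v \<in> verts (Node a cs)" for v
  proof (cases "v = a")
    case True
    then show ?thesis using apex B_ge(1) by simp
  next
    case False
    then obtain c where child: "c \<in> set cs" "v \<in> verts c" using \<open>v \<in> verts (Node a cs)\<close> by auto
    have "real (card (verts c) + 1) * B ^ Suc m \<le> real (card (verts (Node a cs))) * B ^ Suc m"
      using card_less[OF child(1)] B_ge(1) by (intro mult_right_mono) auto
    then show ?thesis using attached_bounds[OF attached[OF child(1)] child(2)] by linarith
  qed
  moreover have "\<exists>x y. e = {x, y} \<and> p y - p x \<in> steps (Suc m)" if "e \<in> edges (Node a cs)" for e
    using attached_steps attached that by fastforce
  ultimately show ?thesis unfolding drawn_def rtree.sel using apex by blast
qed

lemma ex_attached:
  assumes distinct: "distinct_verts (Node a cs)" and less: "\<And>c. c \<in> set cs \<Longrightarrow> i c < d"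
    and drawn: "\<And>c. c \<in> set cs \<Longrightarrow> \<exists>q. drawn (if i c = 0 then Suc m else m) c q"
  shows "\<exists>p. \<forall>c\<in>set cs. attached m a c (i c) p"
proof -
  obtain q where subdrawing: "\<And>c. c \<in> set cs \<Longrightarrow> drawn (if i c = 0 then Suc m else m) c (q c)"
    using drawn by metis
  define P where "P c v = of_real (B ^ Suc m) * u (i c) + q c v" for c v
  obtain f where glued: "\<And>c v. c \<in> set cs \<Longrightarrow> v \<in> verts c \<Longrightarrow> f v = P c v"
    using ex_function_on_disjoint_family[of verts "set cs" P] distinct by auto
  have "attached m a c (i c) (f(a := 0))" if child: "c \<in> set cs" for c
  proof -
    have "(f(a := 0)) v = P c v" if "v \<in> verts c" for v
      using glued[OF child that] that child distinct by auto
    then show ?thesis unfolding attached_def P_def using less[OF child] subdrawing[OF child] by auto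
  qed
  then show ?thesis by blast
qed

lemma ex_drawn:
  assumes "distinct_verts t" "arity_le d t" "levels_le m t" "card (verts t) \<le> n"
  shows "\<exists>p. drawn m t p"
  using assms
proof (induction t arbitrary: m)
  case (Node a cs)
  show ?case
  proof (cases "cs = []")
    case True
    then show ?thesis using drawn_leaf by (intro exI) simp
  next
    case False
    then have "1 \<le> m" using Node.prems(3) by simp
    then obtain k where m_Suc: "m = Suc k" by (cases m) auto
    then obtain h where heavy: "h \<in> set cs"
      and levels: "\<And>c. c \<in> set cs \<Longrightarrow> levels_le (if c = h then Suc k else k) c"
      using Node.prems(3) False unfolding levels_le.simps m_Suc diff_Suc_1 by blast
    have "card (set cs) \<le> d" using Node.prems(2) by simp
    then obtain i where inj: "inj_on i (set cs)" and less: "i ` set cs \<subseteq> {..<d}"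
      and "i h = (0::nat)"
      using ex_inj_on_to_lessThan_zero_at[OF finite_set _ heavy] by blast
    have "\<exists>q. drawn (if i c = 0 then Suc k else k) c q" if child: "c \<in> set cs" for c
    proof (rule Node.IH[OF child])
      show "distinct_verts c" "arity_le d c" using Node.prems(1,2) child by auto
      have "i c = 0 \<longleftrightarrow> c = h" using inj_on_eq_iff[OF inj child heavy] \<open>i h = 0\<close> by simp
      then show "levels_le (if i c = 0 then Suc k else k) c" using levels[OF child] by simp
      show "card (verts c) \<le> n"
        using card_verts_child_less[OF Node.prems(1) child] Node.prems(4) by simp
    qed
    then obtain p where "\<And>c. c \<in> set cs \<Longrightarrow> attached k a c (i c) p"
      using ex_attached[OF Node.prems(1)] less by blast
    then show ?thesis using drawn_Node[OF Node.prems(1,4) False inj] m_Suc by blast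
  qed
qed

lemma step_slope_dist:
  assumes "e = {x, y}" "p y - p x \<in> steps m" and "e = {v, w}"
  obtains i j where "i < d" "1 \<le> j" "j \<le> m"
    "slope (p v) (p w) = slope 0 (u i)" "dist (p v) (p w) = B ^ j"
proof -
  obtain i j where direction_level: "i < d" "1 \<le> j" "j \<le> m"
    and step: "p y - p x = of_real (B ^ j) * u i"
    using assms(2) by (auto simp: steps_def)
  define s :: real where "s = (if v = x \<and> w = y then 1 else - 1)"
  have diff: "p w - p v = of_real (s * B ^ j) * u i"
    using step assms(1,3) by (auto simp: s_def doubleton_eq_iff algebra_simps)
  have "\<bar>s\<bar> = 1" by (simp add: s_def)
  have "s * B ^ j \<noteq> 0" using B_ge(1) by (simp add: s_def)
  then have "slope (p v) (p w) = slope 0 (u i)"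
    using slope_eq_if_parallel[of "p w" "p v" "s * B ^ j" "u i" 0] diff by simp
  moreover have "dist (p v) (p w) = cmod (p w - p v)" by (simp add: dist_norm norm_minus_commute)
  then have "dist (p v) (p w) = B ^ j"
    unfolding diff using norm_u[OF direction_level(1)] B_ge(1) \<open>\<bar>s\<bar> = 1\<close>
    by (simp only: norm_mult norm_of_real abs_mult) simp
  ultimately show thesis using that direction_level by blast
qed

lemma card_slopes_lengths_drawn:
  assumes "drawn m t p"
  shows "card (edge_slopes (edges t) p) \<le> d" "card (edge_lengths (edges t) p) \<le> m"
proof -
  have "\<exists>i j. i < d \<and> 1 \<le> j \<and> j \<le> m \<and>
      slope (p v) (p w) = slope 0 (u i) \<and> dist (p v) (p w) = B ^ j"
    if edge: "{v, w} \<in> edges t" for v w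
  proof -
    obtain x y where "{v, w} = {x, y}" "p y - p x \<in> steps m"
      using assms edge unfolding drawn_def by blast
    then show ?thesis by (rule step_slope_dist[of "{v, w}"]) auto
  qed
  then have "edge_slopes (edges t) p \<subseteq> (\<lambda>i. slope 0 (u i)) ` {..<d}"
    "edge_lengths (edges t) p \<subseteq> (\<lambda>j. B ^ j) ` {1..m}"
    unfolding edge_slopes_def edge_lengths_def by force+
  then show "card (edge_slopes (edges t) p) \<le> d" "card (edge_lengths (edges t) p) \<le> m"
    using surj_card_le[of "{..<d}"] surj_card_le[of "{1..m}"] by simp_all
qed

end

lemma ex_uniform_lower_bound:
  fixes f :: "'a \<Rightarrow> real"
  assumes "finite K" "\<And>x. x \<in> K \<Longrightarrow> 0 < f x" "0 < b"
  shows "\<exists>\<epsilon>>0. \<epsilon> < b \<and> (\<forall>x\<in>K. \<epsilon> < f x)"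
proof -
  have "\<forall>\<^sub>F \<epsilon> in at_right 0. \<epsilon> \<in> {0<..<y}" if "0 < y" for y :: real
    using eventually_at_right_real[OF that] .
  then have "\<forall>\<^sub>F \<epsilon> in at_right 0. \<epsilon> \<in> {0<..<b} \<and> (\<forall>x\<in>K. \<epsilon> \<in> {0<..<f x})"
    using assms by (intro eventually_conj eventually_ball_finite) auto
  from eventually_happens'[OF trivial_limit_at_right_real this] show ?thesis by auto
qed

lemma ex_separated_unit_vectors:
  "\<exists>u :: nat \<Rightarrow> complex. u 0 = 1 \<and> (\<forall>i. cmod (u i) = 1 \<and> 0 < Re (u i)) \<and>
    (\<forall>i>0. Re (u i) \<le> 1/2) \<and> (\<forall>i j. i \<noteq> j \<longrightarrow> Im (cnj (u i) * u j) \<noteq> 0)"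
proof -
  define \<phi> where "\<phi> i = (if i = 0 then 0 else pi/2 - pi/6 / real i)" for i :: nat
  have \<phi>_pos: "pi/3 \<le> \<phi> i" "\<phi> i < pi/2" if "0 < i" for i
  proof -
    have "pi/6 / real i \<le> pi/6 / 1" using that by (intro divide_left_mono) auto
    then show "pi/3 \<le> \<phi> i" "\<phi> i < pi/2" using that by (simp_all add: \<phi>_def)
  qed
  have \<phi>_range: "0 \<le> \<phi> i \<and> \<phi> i < pi/2" for i
  proof (cases "i = 0")
    case True
    then show ?thesis by (simp add: \<phi>_def)
  next
    case False
    then have "pi/3 \<le> \<phi> i" "\<phi> i < pi/2" using \<phi>_pos by auto
    then show ?thesis using pi_gt_zero by linarith
  qed
  have "0 < cos (\<phi> i)" for i using \<phi>_range[of i] by (simp add: cos_gt_zero_pi)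
  moreover have "cos (\<phi> i) \<le> 1/2" if "0 < i" for i
    using \<phi>_pos[OF that] cos_monotone_0_pi_le[of "pi/3" "\<phi> i"] by (simp add: cos_60)
  moreover have "sin (\<phi> j - \<phi> i) \<noteq> 0" if "i \<noteq> j" for i j
  proof -
    have "\<phi> i \<noteq> \<phi> j" using that \<phi>_pos[of i] \<phi>_pos[of j] by (auto simp: \<phi>_def split: if_splits)
    then show ?thesis
      using sin_eq_0_pi[of "\<phi> j - \<phi> i"] \<phi>_range[of i] \<phi>_range[of j] by auto
  qed
  moreover have "\<phi> 0 = 0" by (simp add: \<phi>_def)
  ultimately show ?thesis
    by (intro exI[of _ "\<lambda>i. cis (\<phi> i)"]) (simp add: cis_cnj cis_mult)
qed

lemma ex_directions: "\<exists>u \<epsilon> B. directions d n u \<epsilon> B"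
proof -
  obtain u :: "nat \<Rightarrow> complex" where unit: "u 0 = 1" "\<And>i. cmod (u i) = 1" "\<And>i. 0 < Re (u i)"
      "\<And>i. 0 < i \<Longrightarrow> Re (u i) \<le> 1/2"
    and distinct: "\<And>i j. i \<noteq> j \<Longrightarrow> Im (cnj (u i) * u j) \<noteq> 0"
    using ex_separated_unit_vectors by metis
  define K where "K = {(i, j). i < d \<and> j < d \<and> i \<noteq> j}"
  have "finite K" by (rule finite_subset[of _ "{..<d} \<times> {..<d}"]) (auto simp: K_def)
  moreover have "0 < (\<lambda>(i, j). \<bar>Im (cnj (u i) * u j)\<bar> / 4) x" if "x \<in> K" for x
    using that distinct unfolding K_def by (cases x) simp
  ultimately obtain \<epsilon> :: real where small: "0 < \<epsilon>" "\<epsilon> < 1/2"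
    "\<forall>x\<in>K. \<epsilon> < (\<lambda>(i, j). \<bar>Im (cnj (u i) * u j)\<bar> / 4) x"
    using ex_uniform_lower_bound[of K "\<lambda>(i, j). \<bar>Im (cnj (u i) * u j)\<bar> / 4" "1/2"] by auto
  have "directions d n u \<epsilon> (real (Suc n) / \<epsilon>)"
  proof
    show "4 * \<epsilon> < \<bar>Im (cnj (u i) * u j)\<bar>" if "i < d" "j < d" "i \<noteq> j" for i j
      using bspec[OF small(3), of "(i, j)"] that by (simp add: K_def)
    show "1 \<le> real (Suc n) / \<epsilon>" "real n \<le> \<epsilon> * (real (Suc n) / \<epsilon>)"
      using small(1,2) by (auto simp: field_simps)
  qed (use unit small(1,2) in auto)
  then show ?thesis by blast
qed

lemma ex_plane_drawing_rtree:
  assumes "distinct_verts t" "arity_le d t" "levels_le m t"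
  shows "\<exists>p. plane_drawing (verts t) (edges t) p \<and>
    card (edge_slopes (edges t) p) \<le> d \<and> card (edge_lengths (edges t) p) \<le> m"
proof -
  obtain u \<epsilon> B where "directions d (card (verts t)) u \<epsilon> B" using ex_directions by blast
  then interpret directions d "card (verts t)" u \<epsilon> B .
  obtain p where drawing: "drawn m t p" using ex_drawn[OF assms] by blast
  then have "plane_drawing (verts t) (edges t) p"
    by (intro plane_drawing_if_noncrossing) (simp add: drawn_def)
  then show ?thesis using card_slopes_lengths_drawn[OF drawing] by blast
qed

theorem theorem5:
  fixes V :: "'a set" and E :: "'a set set" and k :: nat
  assumes "graph_tree V E" and "pathwidth V E = k" and "k \<ge> 1"
  shows "\<exists>p :: 'a \<Rightarrow> complex. plane_drawing V E p \<and>
           card (edge_slopes E p) \<le> max (max_degree V E - 1) 1 \<and>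
           card (edge_lengths E p) \<le> 2 * k - 1"
proof -
  obtain k' where k_Suc: "k = Suc k'" using assms(3) by (cases k) auto
  then obtain t where "distinct_verts t" "arity_le (max (max_degree V E - 1) 1) t"
      "levels_le (Suc (2 * k')) t" and "verts t = V" "edges t = E"
    using ex_low_level_rooting[OF assms(1)] assms(2) by blast
  then have "\<exists>p. plane_drawing V E p \<and> card (edge_slopes E p) \<le> max (max_degree V E - 1) 1 \<and>
      card (edge_lengths E p) \<le> Suc (2 * k')"
    using ex_plane_drawing_rtree[of t] by simp
  moreover have "2 * k - 1 = Suc (2 * k')" using k_Suc by simp
  ultimately show ?thesis by simp
qed

end
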